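(* Let $A$ be an FDZ-ring. If the annihilator $\mathrm{Ann}(A)$ is infinite and $\Delta(A)\neq A$, then $A$ is not bi-interpretable (with parameters) with the ring of integers $\mathbb{Z}$.
   Context: A ring is a structure $(A,+,\cdot)$ where $(A,+)$ is an abelian group and $\cdot$ is bilinear (not necessarily associative, commutative or unitary). An FDZ-ring is a ring whose additive group is finitely generated. $\mathrm{Ann}(A)=\{x\in A: xy=yx=0 \text{ for all } y\in A\}$; $A^2$ is the additive subgroup of finite sums of products $xy$; $\Delta(A)=\{x\in A: nx\in A^2 \text{ for some integer } n\ge1\}$. Two structures $\mathbb A,\mathbb B$ in finite signatures are bi-interpretable (with parameters) if there are interpretations of $\mathbb A$ in $\mathbb B$ and of $\mathbb B$ in $\mathbb A$ such that the resulting isomorphisms of $\mathbb A$ with its copy interpreted in itself (via $\mathbb B$), and of $\mathbb B$ with its copy interpreted in itself, are first-order definable (with parameters). *)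

theory Defs
  imports "HOL-Algebra.Generated_Groups" "HOL-Algebra.IntRing"
begin

section \<open>First-order structures and definability with parameters\<close>

text \<open>
  A structure carries its signature: the partial maps \<open>fun_ar\<close> and \<open>rel_ar\<close> give the arities
  of the function and relation symbols; a symbol outside their domain does not belong to the
  signature. Constants are function symbols of arity 0.
\<close>

record ('f, 'r, 'a) fo_structure =
  univ :: "'a set"
  fun_ar :: "'f \<Rightarrow> nat option"
  rel_ar :: "'r \<Rightarrow> nat option"
  fun_of :: "'f \<Rightarrow> 'a list \<Rightarrow> 'a"
  rel_of :: "'r \<Rightarrow> 'a list \<Rightarrow> bool"

text \<open>Variables are de Bruijn indices: \<open>Var i\<close> denotes the \<open>i\<close>-th entry of the environment,
  and a quantifier prepends the quantified element to the environment.\<close>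

datatype 'f fo_term = Var nat | App 'f "'f fo_term list"

datatype ('f, 'r) fo_formula =
    Eq "'f fo_term" "'f fo_term"
  | Rel 'r "'f fo_term list"
  | Neg "('f, 'r) fo_formula"
  | Conj "('f, 'r) fo_formula" "('f, 'r) fo_formula"
  | Exists "('f, 'r) fo_formula"

text \<open>Terms and formulas over the signature of \<open>M\<close>, with free variables among the first \<open>k\<close>.\<close>

primrec wf_term :: "('f, 'r, 'a) fo_structure \<Rightarrow> nat \<Rightarrow> 'f fo_term \<Rightarrow> bool" where
  "wf_term M k (Var i) \<longleftrightarrow> i < k"
| "wf_term M k (App h ts) \<longleftrightarrow> fun_ar M h = Some (length ts) \<and> list_all (wf_term M k) ts"

primrec wf_formula :: "('f, 'r, 'a) fo_structure \<Rightarrow> nat \<Rightarrow> ('f, 'r) fo_formula \<Rightarrow> bool" where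
  "wf_formula M k (Eq s t) \<longleftrightarrow> wf_term M k s \<and> wf_term M k t"
| "wf_formula M k (Rel r ts) \<longleftrightarrow> rel_ar M r = Some (length ts) \<and> list_all (wf_term M k) ts"
| "wf_formula M k (Neg \<phi>) \<longleftrightarrow> wf_formula M k \<phi>"
| "wf_formula M k (Conj \<phi> \<psi>) \<longleftrightarrow> wf_formula M k \<phi> \<and> wf_formula M k \<psi>"
| "wf_formula M k (Exists \<phi>) \<longleftrightarrow> wf_formula M (Suc k) \<phi>"

primrec eval_term :: "('f, 'r, 'a) fo_structure \<Rightarrow> 'a list \<Rightarrow> 'f fo_term \<Rightarrow> 'a" where
  "eval_term M e (Var i) = e ! i"
| "eval_term M e (App h ts) = fun_of M h (map (eval_term M e) ts)"

primrec sat :: "('f, 'r, 'a) fo_structure \<Rightarrow> 'a list \<Rightarrow> ('f, 'r) fo_formula \<Rightarrow> bool" where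
  "sat M e (Eq s t) \<longleftrightarrow> eval_term M e s = eval_term M e t"
| "sat M e (Rel r ts) \<longleftrightarrow> rel_of M r (map (eval_term M e) ts)"
| "sat M e (Neg \<phi>) \<longleftrightarrow> \<not> sat M e \<phi>"
| "sat M e (Conj \<phi> \<psi>) \<longleftrightarrow> sat M e \<phi> \<and> sat M e \<psi>"
| "sat M e (Exists \<phi>) \<longleftrightarrow> (\<exists>x\<in>univ M. sat M (x # e) \<phi>)"

definition tuples :: "'a set \<Rightarrow> nat \<Rightarrow> 'a list set" where
  "tuples S n = {xs. length xs = n \<and> set xs \<subseteq> S}"

definition definable :: "('f, 'r, 'a) fo_structure \<Rightarrow> nat \<Rightarrow> 'a list set \<Rightarrow> bool" where
  "definable M n X \<longleftrightarrow>
     (\<exists>\<phi> ps. set ps \<subseteq> univ M \<and> wf_formula M (n + length ps) \<phi> \<and>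
             X = {xs \<in> tuples (univ M) n. sat M (xs @ ps) \<phi>})"

section \<open>Interpretations and bi-interpretability with parameters\<close>

text \<open>
  \<open>interpretation_in N M n D f\<close>: the coordinate map \<open>f\<close> from the definable set \<open>D\<close> of
  \<open>n\<close>-tuples of \<open>M\<close> onto \<open>N\<close> is an interpretation of \<open>N\<close> in \<open>M\<close>; equivalently, the quotient
  of \<open>D\<close> by the definable equivalence relation \<open>f xs = f ys\<close>, with the induced definable
  operations and relations, is a copy of \<open>N\<close>, and \<open>f\<close> induces the isomorphism from it to \<open>N\<close>.
  Each definable set may use its own parameters; as signatures are finite, this amounts to
  one common finite tuple of parameters.
\<close>

definition interpretation_in ::
  "('g, 's, 'b) fo_structure \<Rightarrow> ('f, 'r, 'a) fo_structure \<Rightarrow> nat \<Rightarrow> 'a list set \<Rightarrow>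
   ('a list \<Rightarrow> 'b) \<Rightarrow> bool" where
  "interpretation_in N M n D f \<longleftrightarrow>
     0 < n \<and> definable M n D \<and> f ` D = univ N \<and>
     definable M (n + n) {xs @ ys | xs ys. xs \<in> D \<and> ys \<in> D \<and> f xs = f ys} \<and>
     (\<forall>h k. fun_ar N h = Some k \<longrightarrow>
        definable M (k * n + n)
          {concat xss @ ys | xss ys. xss \<in> tuples D k \<and> ys \<in> D \<and> fun_of N h (map f xss) = f ys}) \<and>
     (\<forall>r k. rel_ar N r = Some k \<longrightarrow>
        definable M (k * n) {concat xss | xss. xss \<in> tuples D k \<and> rel_of N r (map f xss)})"

text \<open>
  If \<open>f\<close> interprets \<open>N\<close> in \<open>M\<close> (dimension \<open>n\<close>) and \<open>g\<close> interprets \<open>M\<close> in \<open>N\<close> (dimension \<open>m\<close>),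
  then the copy of \<open>M\<close> inside \<open>M\<close> consists of the classes of the \<open>m\<close>-tuples of elements of \<open>D\<close>
  that \<open>f\<close> sends into \<open>E\<close>, and its isomorphism with \<open>M\<close> is induced by the composite of \<open>f\<close> and \<open>g\<close>.
  \<open>composite_graph\<close> is the graph of that isomorphism, with value first.
\<close>

definition composite_graph ::
  "nat \<Rightarrow> 'a list set \<Rightarrow> ('a list \<Rightarrow> 'b) \<Rightarrow> 'b list set \<Rightarrow> ('b list \<Rightarrow> 'a) \<Rightarrow> 'a list set" where
  "composite_graph m D f E g =
     {g (map f xss) # concat xss | xss. xss \<in> tuples D m \<and> map f xss \<in> E}"

definition bi_interpretable ::
  "('f, 'r, 'a) fo_structure \<Rightarrow> ('g, 's, 'b) fo_structure \<Rightarrow> bool" where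
  "bi_interpretable M N \<longleftrightarrow>
     (\<exists>n D f m E g.
        interpretation_in N M n D f \<and> interpretation_in M N m E g \<and>
        definable M (1 + m * n) (composite_graph m D f E g) \<and>
        definable N (1 + n * m) (composite_graph n E g D f))"

section \<open>FDZ-rings\<close>

text \<open>
  Rings are not assumed associative, commutative or unitary. The record type of HOL-Algebra is
  reused; its field \<open>one\<close> is unconstrained and never used.
\<close>

locale nonassoc_ring = abelian_group R for R (structure) +
  assumes m_closed: "\<lbrakk>x \<in> carrier R; y \<in> carrier R\<rbrakk> \<Longrightarrow> x \<otimes> y \<in> carrier R"
    and l_distr: "\<lbrakk>x \<in> carrier R; y \<in> carrier R; z \<in> carrier R\<rbrakk>
          \<Longrightarrow> (x \<oplus> y) \<otimes> z = x \<otimes> z \<oplus> y \<otimes> z"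
    and r_distr: "\<lbrakk>x \<in> carrier R; y \<in> carrier R; z \<in> carrier R\<rbrakk>
          \<Longrightarrow> z \<otimes> (x \<oplus> y) = z \<otimes> x \<oplus> z \<otimes> y"

locale FDZ_ring = nonassoc_ring +
  assumes additively_fin_gen:
    "\<exists>S. finite S \<and> S \<subseteq> carrier R \<and> generate (add_monoid R) S = carrier R"

definition Ann :: "('a, 'm) ring_scheme \<Rightarrow> 'a set" where
  "Ann R = {x \<in> carrier R. \<forall>y \<in> carrier R. x \<otimes>\<^bsub>R\<^esub> y = \<zero>\<^bsub>R\<^esub> \<and> y \<otimes>\<^bsub>R\<^esub> x = \<zero>\<^bsub>R\<^esub>}"

definition ring_square :: "('a, 'm) ring_scheme \<Rightarrow> 'a set" where
  "ring_square R =
     generate (add_monoid R) {x \<otimes>\<^bsub>R\<^esub> y | x y. x \<in> carrier R \<and> y \<in> carrier R}"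

definition Delta :: "('a, 'm) ring_scheme \<Rightarrow> 'a set" where
  "Delta R = {x \<in> carrier R. \<exists>n::nat. 1 \<le> n \<and> [n] \<cdot>\<^bsub>R\<^esub> x \<in> ring_square R}"

text \<open>The signature of rings consists of two binary function symbols (zero, negation and, where
  it exists, the unit are definable); the unused type of relation symbols is \<open>unit\<close>.\<close>

datatype ring_op = Add | Mult

definition ring_structure :: "('a, 'm) ring_scheme \<Rightarrow> (ring_op, unit, 'a) fo_structure" where
  "ring_structure R =
     \<lparr>univ = carrier R,
      fun_ar = (\<lambda>_. Some 2),
      rel_ar = (\<lambda>_. None),
      fun_of = (\<lambda>h xs. case h of Add \<Rightarrow> xs ! 0 \<oplus>\<^bsub>R\<^esub> xs ! 1 | Mult \<Rightarrow> xs ! 0 \<otimes>\<^bsub>R\<^esub> xs ! 1),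
      rel_of = (\<lambda>_ _. False)\<rparr>"

end

(*
  Let U be a free ultrafilter on the naturals. Choose an additive map \<rho> : A -> Z that vanishes on
  \<Delta>(A) and is not zero, an element a of Ann(A) of infinite order, and a map \<theta> on the ultrapower Z*
  of the form \<theta>(k) = \<chi>(k) d, where d = (n!) is divisible by every standard integer and \<chi> : Z* -> Q
  is additive with \<chi>(1) = \<chi>(d) = 0 and \<chi>(d^2) = 1. Then \<sigma>(x) = x + \<theta>(\<rho> x) a is an automorphism of the
  ultrapower A* that fixes A pointwise. An interpretation f of Z in A therefore transports \<sigma> to a
  ring automorphism \<tau> of Z*, compatible with \<sigma> along the definable isomorphism of A with the copy of A
  interpreted in it. Since recursion is definable in Z, so is the sequence k |-> k a, and hence
  \<sigma>(k a) = \<tau>(k) a, that is, \<tau>(k) = k + \<rho>(a) \<theta>(k) for k >= 0. If \<rho>(a) = 0, then \<tau> and hence \<sigma> would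
  be the identity, which it is not. Otherwise the multiplicativity of \<tau> at k = d^2 makes
  2 d^2 + \<rho>(a) d a standard rational, and applying \<chi> gives 2 = 0.
  No quotient is formed: elements of an ultrapower are functions, compared almost everywhere.
*)

theory Submission
  imports Defs "HOL-Library.Function_Algebras" "HOL-Number_Theory.Cong"
    "HOL-Computational_Algebra.Computational_Algebra"
begin

section \<open>Ultrafilters and rational functionals\<close>

text \<open>In A itself an automorphism fixing a finite generating set is trivial; the ultrapower
  leaves room for a nontrivial one that fixes every possible parameter. However, Z* may also have
  nontrivial automorphisms fixing Z, so nontriviality of \<sigma> alone contradicts nothing, and
  \<tau> has to be computed. The conditions on \<chi> have separate purposes: \<chi>(1) = 0 makes
  \<sigma> fix A, \<chi>(d) = 0 makes \<theta> vanish on multiples of its own values, which gives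
  \<sigma> an inverse, and \<chi>(d^2) = 1 makes \<sigma> nontrivial. The values of \<chi> are
  rational because functionals extend from subspaces over a field; the divisibility of d turns
  \<chi>(k) d back into an integer. The distinction on \<rho>(a) cannot be avoided by a choice of a:
  Ann(A) may lie inside \<Delta>(A), where \<rho> vanishes, or meet it only in torsion.\<close>

lemma ultrafilter_extension:
  fixes F :: "'i filter"
  assumes "F \<noteq> bot"
  shows "\<exists>U\<le>F. U \<noteq> bot \<and> (\<forall>P. eventually P U \<or> eventually (\<lambda>i. \<not> P i) U)"
proof -
  let ?A = "{G. G \<le> F \<and> G \<noteq> bot}"
  \<comment> \<open>The order is reversed, so that Zorn's lemma yields a minimal proper
    filter.\<close>
  have po: "partial_order_on ?A (relation_of (\<ge>) ?A)"
    by (rule partial_order_on_relation_ofI) auto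
  have bound: "\<exists>u\<in>?A. \<forall>G\<in>C. u \<le> G" if C: "C \<in> Chains (relation_of (\<ge>) ?A)" for C
  proof (cases "C = {}")
    case True
    then show ?thesis using assms by auto
  next
    case False
    have CA: "C \<subseteq> ?A"
      using C by (auto simp: Chains_def relation_of_def)
    have "\<exists>H\<in>C. H \<le> inf G G'" if "G \<in> C" "G' \<in> C" for G G'
    proof -
      have "G \<le> G' \<or> G' \<le> G"
        using C that by (auto simp: Chains_def relation_of_def)
      then show ?thesis
        using that by (auto simp: inf_absorb1 inf_absorb2)
    qed
    then have Inf_C: "eventually P (Inf C) \<longleftrightarrow> (\<exists>G\<in>C. eventually P G)" for P
      by (rule eventually_Inf_base[OF False])
    have "Inf C \<noteq> bot"
    proof
      assume "Inf C = bot"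
      then obtain G where "G \<in> C" "eventually (\<lambda>_. False) G"
        using Inf_C[of "\<lambda>_. False"] by auto
      then have "G = bot" by (simp add: trivial_limit_def)
      then show False using \<open>G \<in> C\<close> CA by blast
    qed
    moreover have "Inf C \<le> F"
    proof -
      obtain G where "G \<in> C" using False by blast
      then show ?thesis using CA by (intro Inf_lower2[of G]) blast+
    qed
    ultimately show ?thesis
      by (intro bexI[of _ "Inf C"] ballI Inf_lower) simp_all
  qed
  obtain U where U: "U \<in> ?A" and min: "\<And>G. G \<in> ?A \<Longrightarrow> G \<le> U \<Longrightarrow> G = U"
    using predicate_Zorn[OF po bound] by auto
  \<comment> \<open>Meeting U with the set where P holds gives either the improper filter, and then
    the negation of P holds eventually, or by minimality U itself.\<close>
  have "eventually P U \<or> eventually (\<lambda>i. \<not> P i) U" for P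
  proof (cases "inf U (principal {i. P i}) = bot")
    case True
    then show ?thesis
      by (simp add: trivial_limit_def eventually_inf_principal)
  next
    case False
    then have "inf U (principal {i. P i}) = U"
      using U by (intro min) (auto intro: le_infI1)
    then have "U \<le> principal {i. P i}"
      by (metis inf.cobounded2)
    then show ?thesis
      by (simp add: le_principal)
  qed
  then show ?thesis using U by blast
qed

text \<open>A basis of V stays independent when e is added, so the indicator of e on it extends
  linearly. On coefficient vectors this produces \<rho>, on rational sequences \<chi>.\<close>

lemma rational_functional_separating:
  fixes V :: "('i \<Rightarrow> rat) set"
  assumes zero: "(\<lambda>i. 0) \<in> V"
    and add: "\<And>x y. x \<in> V \<Longrightarrow> y \<in> V \<Longrightarrow> (\<lambda>i. x i + y i) \<in> V"
    and scale: "\<And>r x. x \<in> V \<Longrightarrow> (\<lambda>i. r * x i) \<in> V"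
    and e: "e \<notin> V"
  shows "\<exists>\<chi> :: ('i \<Rightarrow> rat) \<Rightarrow> rat. (\<forall>x y. \<chi> (\<lambda>i. x i + y i) = \<chi> x + \<chi> y) \<and>
    (\<forall>r x. \<chi> (\<lambda>i. r * x i) = r * \<chi> x) \<and> (\<forall>x\<in>V. \<chi> x = 0) \<and> \<chi> e = 1"
proof -
  let ?s = "\<lambda>(r::rat) (x::'i \<Rightarrow> rat) i. r * x i"
  interpret vector_space_pair ?s "(*) :: rat \<Rightarrow> rat \<Rightarrow> rat"
    by unfold_locales (auto simp: fun_eq_iff algebra_simps)
  have V: "vs1.subspace V"
    unfolding vs1.subspace_def using assms by (auto simp: zero_fun_def plus_fun_def)
  obtain B where B: "V = vs1.span B" "vs1.independent B"
    using vs1.maximal_independent_subset[of V] vs1.span_minimal[OF _ V] by (metis subset_antisym)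
  have "vs1.independent (insert e B)"
    using B e by (simp add: vs1.independent_insert)
  then obtain \<chi> where lin: "Vector_Spaces.linear ?s (*) \<chi>" and on: "\<And>x. x \<in> insert e B \<Longrightarrow> \<chi> x = (if x = e then 1 else 0)"
    using linear_independent_extend[of "insert e B" "\<lambda>x. if x = e then 1 else 0"] by blast
  interpret lin: Vector_Spaces.linear ?s "(*)" \<chi> by fact
  have "\<chi> x = 0" if "x \<in> V" for x
  proof -
    have "x \<in> vs1.span B" using that B by simp
    then show ?thesis
    proof (rule lin.eq_0_on_span[rotated])
      show "\<chi> y = 0" if "y \<in> B" for y
        using on[of y] that e B vs1.span_base[of y B] by auto
    qed
  qed
  moreover have "\<chi> (\<lambda>i. x i + y i) = \<chi> x + \<chi> y" for x y
    using lin.add[of x y] by (simp add: plus_fun_def)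
  moreover have "\<chi> (\<lambda>i. r * x i) = r * \<chi> x" for r x
    using lin.scale by simp
  ultimately show ?thesis
    using on[of e] by (intro exI[of _ \<chi>]) auto
qed

section \<open>Definability of order and of finite sequences in the integers\<close>

definition sum_of_four_squares :: "int \<Rightarrow> bool" where
  "sum_of_four_squares n \<longleftrightarrow> (\<exists>a b c d. n = a * a + b * b + c * c + d * d)"

text \<open>Euler's identity, that is, multiplicativity of the quaternion norm: up to sign,
  \<open>p\<close>, \<open>q\<close>, \<open>r\<close>, \<open>s\<close> are the coordinates of the
  product of a + bi + cj + dk with the conjugate of e + fi + gj + hk.\<close>

lemma sum_of_four_squares_mult:
  assumes "sum_of_four_squares m" "sum_of_four_squares n"
  shows "sum_of_four_squares (m * n)"
proof -
  obtain a b c d where m: "m = a * a + b * b + c * c + d * d"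
    using assms(1) by (auto simp: sum_of_four_squares_def)
  obtain e f g h where n: "n = e * e + f * f + g * g + h * h"
    using assms(2) by (auto simp: sum_of_four_squares_def)
  define p q r s where "p = a*e + b*f + c*g + d*h" and "q = a*f - b*e + c*h - d*g"
    and "r = a*g - b*h - c*e + d*f" and "s = a*h + b*g - c*f - d*e"
  have "m * n = p * p + q * q + r * r + s * s"
    unfolding m n p_def q_def r_def s_def by (simp add: algebra_simps)
  then show ?thesis
    unfolding sum_of_four_squares_def by blast
qed

text \<open>Pigeonhole for odd p = 2h + 1: for x and y in 0..h the residues of x^2 are distinct, as
  are those of -1 - y^2, and two sets of h + 1 residues modulo p must meet. The range up to h also
  keeps the sum below p^2, which gives m < p and feeds the induction below.\<close>

lemma prime_divides_one_plus_two_squares: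
  fixes p :: int
  assumes "prime p"
  shows "\<exists>x y m. 1 + x * x + y * y = m * p \<and> 0 < m \<and> m < p"
proof (cases "p = 2")
  case True
  then show ?thesis
    by (intro exI[of _ 1] exI[of _ 0]) auto
next
  case False
  then have "odd p" "p > 2"
    using assms prime_odd_int[of p] prime_ge_2_int[of p] by linarith+
  then obtain h where h: "p = 2 * h + 1"
    by (auto elim: oddE)
  have h1: "h \<ge> 1"
    using h \<open>p > 2\<close> by simp
  have dvd: "x = y" if "x \<in> {0..h}" "y \<in> {0..h}" "p dvd x * x - y * y" for x y
  proof -
    have "p dvd (x - y) * (x + y)"
      using that(3) by (simp add: algebra_simps)
    then have "p dvd x - y \<or> p dvd x + y"
      using assms by (simp add: prime_dvd_mult_iff)
    then show ?thesis
    proof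
      assume "p dvd x - y"
      moreover have "\<bar>x - y\<bar> < p" using that h by auto
      ultimately show ?thesis using dvd_imp_le_int[of "x - y" p] by force
    next
      assume "p dvd x + y"
      moreover have "x + y < p" "x + y \<ge> 0" using that h by auto
      ultimately have "x + y = 0" using zdvd_not_zless[of "x + y" p] by linarith
      then show ?thesis using that by auto
    qed
  qed
  let ?f = "\<lambda>x. (x * x) mod p" and ?g = "\<lambda>y. (- 1 - y * y) mod p"
  have inj_f: "inj_on ?f {0..h}"
    by (rule inj_onI) (auto intro!: dvd simp: mod_eq_dvd_iff)
  have inj_g: "inj_on ?g {0..h}"
  proof (rule inj_onI)
    fix x y assume xy: "x \<in> {0..h}" "y \<in> {0..h}" "?g x = ?g y"
    then have "p dvd (- 1 - x * x) - (- 1 - y * y)"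
      by (simp only: mod_eq_dvd_iff)
    then have "p dvd y * y - x * x" by (simp add: algebra_simps)
    then show "x = y" using dvd[of y x] xy by auto
  qed
  have "?f ` {0..h} \<inter> ?g ` {0..h} \<noteq> {}"
  proof
    assume "?f ` {0..h} \<inter> ?g ` {0..h} = {}"
    then have "card (?f ` {0..h} \<union> ?g ` {0..h}) = card {0..h} + card {0..h}"
      by (subst card_Un_disjoint) (auto simp: card_image[OF inj_f] card_image[OF inj_g])
    moreover have "card (?f ` {0..h} \<union> ?g ` {0..h}) \<le> card {0..<p}"
      using \<open>p > 2\<close> by (intro card_mono) auto
    ultimately show False
      using h h1 by simp
  qed
  then obtain x y where xy: "x \<in> {0..h}" "y \<in> {0..h}" "?f x = ?g y"
    by blast
  then have "p dvd x * x - (- 1 - y * y)"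
    by (simp only: mod_eq_dvd_iff)
  then have "p dvd 1 + x * x + y * y"
    by (simp add: algebra_simps)
  then obtain m where m: "1 + x * x + y * y = m * p"
    by (auto simp: dvd_def mult.commute)
  have "x * x \<le> h * h" "y * y \<le> h * h"
    using xy by (auto intro: mult_mono)
  moreover have "1 + h * h + h * h < p * p"
  proof -
    have "p * p - (1 + h * h + h * h) = 2 * (h * h) + 4 * h"
      unfolding h by (simp add: algebra_simps)
    then show ?thesis
      using h1 zero_le_square[of h] by linarith
  qed
  ultimately have "m * p < p * p"
    using m by linarith
  moreover have "0 < m * p"
    unfolding m[symmetric] using zero_le_square[of x] zero_le_square[of y] by linarith
  ultimately show ?thesis
    using m \<open>p > 2\<close> by (intro exI[of _ x] exI[of _ y] exI[of _ m]) (auto simp: zero_less_mult_iff)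
qed

text \<open>Strong induction. For a prime n some m n with m < n is a sum of four squares, and so is
  q^2 m by induction; their product is (q m)^2 n. Composite n are products of smaller cases.\<close>

lemma square_multiple_sum_of_four_squares:
  "n > 0 \<Longrightarrow> \<exists>q. q \<noteq> 0 \<and> sum_of_four_squares (q * q * int n)"
proof (induction n rule: less_induct)
  case (less n)
  have mult: "\<exists>q. q \<noteq> 0 \<and> sum_of_four_squares (q * q * (x * y))"
    if "q \<noteq> 0" "sum_of_four_squares (q * q * x)" "r \<noteq> 0" "sum_of_four_squares (r * r * y)" for q r x y
    using sum_of_four_squares_mult[OF that(2) that(4)] that
    by (intro exI[of _ "q * r"]) (auto simp: algebra_simps)
  consider "n = 1" | "prime n" | "n \<noteq> 1" "\<not> prime n"
    by blast
  then show ?case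
  proof cases
    case 1
    then show ?thesis
      unfolding sum_of_four_squares_def
      by (intro exI[of _ 1] conjI exI[of _ 1] exI[of _ 0]) simp_all
  next
    case 2
    then have "prime (int n)" by simp
    then obtain x y m where m: "1 + x * x + y * y = m * int n" "0 < m" "m < int n"
      using prime_divides_one_plus_two_squares by blast
    obtain q where q: "q \<noteq> 0" "sum_of_four_squares (q * q * m)"
      using less.IH[of "nat m"] m by (auto simp: nat_less_iff)
    have "sum_of_four_squares (m * int n)"
      unfolding m(1)[symmetric] sum_of_four_squares_def
      by (intro exI[of _ 1] exI[of _ x] exI[of _ y] exI[of _ 0]) simp
    from sum_of_four_squares_mult[OF q(2) this] show ?thesis
      using q m by (intro exI[of _ "q * m"]) (auto simp: algebra_simps)
  next
    case 3
    then obtain k where k: "prime k" "k dvd n" "k \<noteq> n"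
      using prime_factor_nat[of n] by blast
    then obtain l where "n = k * l"
      by blast
    then have "n = k * l" "1 < k" "k < n" "1 < l" "l < n"
      using k less.prems prime_gt_1_nat[of k] by (cases "l = 1"; auto)+
    then show ?thesis
      using less.IH[of k] less.IH[of l] mult by auto
  qed
qed

text \<open>This makes the order of the integers first-order definable in the ring language; allowing
  the denominator \<open>q\<close> avoids the descent in Lagrange's four-square theorem.\<close>

lemma nonneg_iff_square_multiple:
  "0 \<le> (x::int) \<longleftrightarrow>
    (\<exists>q a b c d. \<not> q = 0 \<and> q * q * x = a * a + b * b + c * c + d * d)"
proof
  assume "0 \<le> x"
  then consider "x = 0" | "0 < nat x" by linarith
  then show "\<exists>q a b c d. \<not> q = 0 \<and> q * q * x = a * a + b * b + c * c + d * d"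
  proof cases
    case 1
    then show ?thesis by (intro exI[of _ 1] exI[of _ 0]) auto
  next
    case 2
    from square_multiple_sum_of_four_squares[OF this] show ?thesis
      using \<open>0 \<le> x\<close> unfolding sum_of_four_squares_def by simp
  qed
next
  assume "\<exists>q a b c d. \<not> q = 0 \<and> q * q * x = a * a + b * b + c * c + d * d"
  then obtain q a b c d where q: "q \<noteq> 0" and eq: "q * q * x = a * a + b * b + c * c + d * d"
    by blast
  have "0 \<le> q * q * x"
    unfolding eq by (intro add_nonneg_nonneg zero_le_square)
  moreover have "0 < q * q"
    using q by (simp add: zero_less_mult_iff) linarith
  ultimately show "0 \<le> x"
    by (simp add: zero_le_mult_iff)
qed

text \<open>A common prime factor p cannot divide t, since it would then divide 1. It divides (j -
  i) t, hence j - i, hence k!, hence t after all.\<close>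

lemma coprime_beta_moduli:
  fixes t :: nat
  assumes "i \<le> k" "j \<le> k" "i \<noteq> j" "fact k dvd t"
  shows "coprime (1 + (i + 1) * t) (1 + (j + 1) * t)"
proof -
  have *: "coprime (1 + (i + 1) * t) (1 + (j + 1) * t)" if "i < j" "j \<le> k" for i j
  proof (rule ccontr)
    assume "\<not> ?thesis"
    then obtain c where c: "c dvd 1 + (i + 1) * t" "c dvd 1 + (j + 1) * t" "c \<noteq> 1"
      by (auto elim: not_coprimeE)
    obtain p where "prime p" "p dvd c"
      using prime_factor_nat[OF c(3)] by blast
    with c have p: "prime p" "p dvd 1 + (i + 1) * t" "p dvd 1 + (j + 1) * t"
      by (auto dest: dvd_trans)
    have nt: "\<not> p dvd t"
    proof
      assume "p dvd t"
      then have "p dvd 1"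
        using p(2) by (metis dvd_add_left_iff dvd_mult)
      then show False using p(1) by simp
    qed
    have "p dvd (1 + (j + 1) * t) - (1 + (i + 1) * t)"
      using p by (intro dvd_diff_nat)
    also have "(1 + (j + 1) * t) - (1 + (i + 1) * t) = (j - i) * t"
      using that by (simp add: diff_mult_distrib)
    finally have "p dvd j - i"
      using p(1) nt by (simp add: prime_dvd_mult_iff)
    moreover have "j - i dvd fact k"
      using that by (intro dvd_fact) auto
    ultimately show False
      using nt assms(4) by (meson dvd_trans)
  qed
  show ?thesis
    using *[of i j] *[of j i] assms by (metis coprime_commute nat_neq_iff)
qed

text \<open>Goedel's beta function, with a bound \<open>M\<close> selecting the representative of the residue class.\<close>

lemma beta_function:
  fixes u :: "nat \<Rightarrow> nat \<Rightarrow> int"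
  obtains t M :: int and s :: "nat \<Rightarrow> int"
  where "\<And>i j w. i \<le> k \<Longrightarrow> j < m \<Longrightarrow>
    w = u i j \<longleftrightarrow> (1 + (int i + 1) * t) dvd s j - w \<and> - M \<le> w \<and> w \<le> M"
proof -
  define N where "N = Max (insert 0 ((\<lambda>(i, j). nat \<bar>u i j\<bar>) ` ({..k} \<times> {..<m})))"
  have N: "\<bar>u i j\<bar> \<le> int N" if "i \<le> k" "j < m" for i j
  proof -
    have "nat \<bar>u i j\<bar> \<le> N"
      unfolding N_def using that by (intro Max_ge) auto
    then show ?thesis by simp
  qed
  \<comment> \<open>The factorial makes \<open>t\<close> divisible by k!, for coprimality, and
    larger than 2 N, so that a residue determines its representative between -N and N.\<close>
  define t :: nat where "t = fact (k + 2 * N + 1)"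
  have t: "t \<ge> 2 * N + 1"
    unfolding t_def using fact_ge_self[of "k + 2 * N + 1"] by linarith
  have k_t: "fact k dvd t"
    unfolding t_def by (intro fact_dvd) auto
  \<comment> \<open>The Chinese remainder theorem is applied to natural numbers, so the values are
    shifted by N; the shift is undone when \<open>s\<close> is handed over.\<close>
  have "\<exists>s. \<forall>i\<in>{..k}. [s = nat (u i j + int N)] (mod 1 + (i + 1) * t)" for j
    using coprime_beta_moduli[OF _ _ _ k_t] by (intro chinese_remainder_nat) auto
  then obtain s where s: "\<And>i j. i \<le> k \<Longrightarrow> [s j = nat (u i j + int N)] (mod 1 + (i + 1) * t)"
    by (metis atMost_iff)
  show thesis
  proof (rule that[of "int t" "\<lambda>j. int (s j) - int N" "int N"])
    fix i j w assume ij: "i \<le> k" "j < m"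
    let ?p = "1 + (int i + 1) * int t"
    have "[int (s j) = int (nat (u i j + int N))] (mod int (1 + (i + 1) * t))"
      using s[OF ij(1), of j] by (simp only: cong_int_iff)
    then have "?p dvd int (s j) - (u i j + int N)"
      using N[OF ij] by (simp add: cong_iff_dvd_diff algebra_simps abs_le_iff split: if_splits)
    then have d: "?p dvd int (s j) - int N - u i j"
      by (simp add: algebra_simps)
    show "w = u i j \<longleftrightarrow> ?p dvd int (s j) - int N - w \<and> - int N \<le> w \<and> w \<le> int N"
    proof
      assume "w = u i j"
      then show "?p dvd int (s j) - int N - w \<and> - int N \<le> w \<and> w \<le> int N"
        using d N[OF ij] by auto
    next
      assume w: "?p dvd int (s j) - int N - w \<and> - int N \<le> w \<and> w \<le> int N"
      then have "?p dvd (int (s j) - int N - u i j) - (int (s j) - int N - w)"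
        using d dvd_diff by blast
      then have "?p dvd w - u i j"
        by (simp add: algebra_simps)
      moreover have "\<bar>w - u i j\<bar> < ?p"
      proof -
        have "\<bar>w - u i j\<bar> \<le> 2 * int N" using w N[OF ij] by linarith
        also have "\<dots> < 1 * int t" using t by linarith
        also have "\<dots> \<le> (int i + 1) * int t" by (intro mult_right_mono) auto
        finally show ?thesis by linarith
      qed
      ultimately show "w = u i j"
        using dvd_imp_le_int[of "w - u i j" ?p] by force
    qed
  qed
qed

section \<open>Finitely generated abelian groups\<close>

lemma common_denominator:
  fixes f :: "'b \<Rightarrow> rat"
  assumes "finite S"
  shows "\<exists>Q::int. 0 < Q \<and> (\<forall>s\<in>S. of_int Q * f s \<in> \<int>)"
  using assms
proof (induction S)
  case empty
  then show ?case by (auto intro: exI[of _ 1])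
next
  case (insert s S)
  then obtain Q :: int where Q: "0 < Q" "\<forall>s\<in>S. of_int Q * f s \<in> \<int>"
    by blast
  obtain p q where pq: "quotient_of (f s) = (p, q)"
    by (cases "quotient_of (f s)")
  then have f: "f s = of_int p / of_int q" and q: "0 < q"
    using quotient_of_div quotient_of_denom_pos by blast+
  have "of_int (q * Q) * f s = of_int (Q * p)"
    using q by (simp add: f)
  then have "of_int (q * Q) * f s \<in> \<int>"
    by (metis Ints_of_int)
  moreover have "of_int (q * Q) * f r \<in> \<int>" if "r \<in> S" for r
  proof -
    have "of_int (q * Q) * f r = of_int q * (of_int Q * f r)" by simp
    then show ?thesis using Q(2) that by (metis Ints_mult Ints_of_int)
  qed
  ultimately show ?case
    using Q q by (intro exI[of _ "q * Q"]) auto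
qed

context comm_group
begin

lemma generate_insert_decompose:
  assumes "s \<in> carrier G" "S \<subseteq> carrier G" "x \<in> generate G (insert s S)"
  shows "\<exists>h\<in>generate G S. \<exists>k::int. x = h \<otimes> s [^] k"
  using assms(3)
proof (induction rule: generate.induct)
  case one
  then show ?case using generate.one[of G S] by (intro bexI[of _ "\<one>"] exI[of _ 0]) auto
next
  case (incl h)
  then show ?case
  proof
    assume "h = s"
    then show ?thesis using assms(1) generate.one[of G S]
      by (intro bexI[of _ "\<one>"] exI[of _ 1]) auto
  next
    assume "h \<in> S"
    then show ?thesis using assms(2) generate.incl[of h S G]
      by (intro bexI[of _ h] exI[of _ 0]) auto
  qed
next
  case (inv h)
  then show ?case
  proof
    assume "h = s"
    then show ?thesis using assms(1) generate.one[of G S]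
      by (intro bexI[of _ "\<one>"] exI[of _ "-1"]) (auto simp: int_pow_neg)
  next
    assume "h \<in> S"
    then show ?thesis using assms(2) generate.inv[of h S G]
      by (intro bexI[of _ "inv h"] exI[of _ 0]) auto
  qed
next
  case (eng h1 h2)
  then obtain g1 k1 g2 k2 where "g1 \<in> generate G S" "h1 = g1 \<otimes> s [^] (k1::int)"
    "g2 \<in> generate G S" "h2 = g2 \<otimes> s [^] (k2::int)" by blast
  moreover have "g1 \<in> carrier G" "g2 \<in> carrier G"
    using calculation generate_in_carrier[OF assms(2)] by auto
  ultimately show ?case
    using assms(1) generate.eng[of g1 G S g2]
    by (intro bexI[of _ "g1 \<otimes> g2"] exI[of _ "k1 + k2"]) (auto simp: int_pow_mult m_ac)
qed

text \<open>Induction on the generators. With H generated by S, the part of B inside H is finite by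
  induction, and B modulo that part embeds into the exponents of s. It is therefore trivial or
  generated by one element b, which has finite order because B is torsion.\<close>

lemma finite_torsion_subgroup:
  assumes "finite S" "S \<subseteq> carrier G" "subgroup B G" "B \<subseteq> generate G S"
    and "\<And>x. x \<in> B \<Longrightarrow> \<exists>n>0. x [^] (n::nat) = \<one>"
  shows "finite B"
  using assms
proof (induction S arbitrary: B)
  case empty
  then have "B \<subseteq> {\<one>}"
    by (simp add: generate_empty)
  then show ?case by (rule finite_subset) simp
next
  case (insert s S)
  have s: "s \<in> carrier G" and S: "S \<subseteq> carrier G"
    using insert.prems by auto
  interpret B: subgroup B G by fact
  let ?H = "generate G S"
  have H: "subgroup ?H G" "?H \<subseteq> carrier G"
    using generate_is_subgroup[OF S] generate_incl[OF S] by auto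
  interpret H: subgroup ?H G by fact
  let ?coset = "\<lambda>k::int. \<exists>h\<in>?H. h \<otimes> s [^] k \<in> B"
  have fin: "finite (B \<inter> ?H)"
    using insert.prems H by (intro insert.IH S subgroups_Inter_pair) auto
  show ?case
  proof (cases "\<exists>k>0. ?coset k")
    case False
    have "B \<subseteq> B \<inter> ?H"
    proof
      fix x assume x: "x \<in> B"
      then obtain h k where hk: "h \<in> ?H" "x = h \<otimes> s [^] (k::int)"
        using generate_insert_decompose[OF s S] insert.prems by blast
      have "h \<in> carrier G" using hk H by auto
      have "inv x = inv h \<otimes> s [^] (- k)"
        using hk s H by (auto simp: inv_mult int_pow_neg)
      \<comment> \<open>Exponents come in opposite pairs, so without positive ones only 0 is
        left.\<close>
      then have "?coset (- k)" "?coset k"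
        using x hk B.m_inv_closed[of x] H.m_inv_closed[of h] by auto
      then have "k = 0"
        using False by (metis neg_0_less_iff_less linorder_neqE_linordered_idom)
      then show "x \<in> B \<inter> ?H" using x hk \<open>h \<in> carrier G\<close> by simp
    qed
    then show ?thesis using fin finite_subset by blast
  next
    case True
    define K where "K = (LEAST n::nat. 0 < n \<and> ?coset (int n))"
    have "\<exists>n::nat. 0 < n \<and> ?coset (int n)"
      using True by (metis pos_int_cases)
    from LeastI_ex[OF this] have K: "0 < K" "?coset (int K)"
      unfolding K_def by blast+
    have K_min: "K \<le> n" if "0 < n" "?coset (int n)" for n
      unfolding K_def using that by (intro Least_le conjI)
    obtain h0 where h0: "h0 \<in> ?H" "h0 \<otimes> s [^] int K \<in> B"
      using K by blast
    define b where "b = h0 \<otimes> s [^] int K"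
    have b: "b \<in> B" "b \<in> carrier G" "h0 \<in> carrier G"
      using h0 b_def H by auto
    obtain n :: nat where n: "0 < n" "b [^] n = \<one>"
      using insert.prems(4) b by blast
    have "B \<subseteq> (\<lambda>(x, i). x \<otimes> b [^] i) ` ((B \<inter> ?H) \<times> {0..<int n})"
    proof
      fix x assume x: "x \<in> B"
      then obtain h k where hk: "h \<in> ?H" "x = h \<otimes> s [^] (k::int)"
        using generate_insert_decompose[OF s S] insert.prems by blast
      have hc: "h \<in> carrier G" "x \<in> carrier G" using hk H x by auto
      \<comment> \<open>Division with remainder: removing b^q from x leaves an element of B with
        s-exponent k mod K, and the minimality of K makes that exponent 0.\<close>
      define q where "q = k div int K"
      define y where "y = x \<otimes> b [^] (- q)"
      have pw: "b [^] i = h0 [^] i \<otimes> s [^] (int K * i)" for i :: int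
        using b s by (simp add: b_def int_pow_distrib int_pow_pow)
      have yB: "y \<in> B"
        unfolding y_def using x b by (intro B.m_closed subgroup_int_pow_closed \<open>subgroup B G\<close>) auto
      have "y = (h \<otimes> h0 [^] (- q)) \<otimes> (s [^] k \<otimes> s [^] (int K * (- q)))"
        unfolding y_def pw hk(2) using hc b s by (simp add: m_ac)
      also have "s [^] k \<otimes> s [^] (int K * (- q)) = s [^] (k mod int K)"
        using s by (simp add: int_pow_mult[symmetric] q_def minus_mult_div_eq_mod)
      finally have y: "y = (h \<otimes> h0 [^] (- q)) \<otimes> s [^] (k mod int K)" .
      have hH: "h \<otimes> h0 [^] (- q) \<in> ?H"
        using hk h0 by (intro H.m_closed subgroup_int_pow_closed H) auto
      have "k mod int K = 0"
      proof (rule ccontr)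
        assume "k mod int K \<noteq> 0"
        then have pos: "0 < k mod int K"
          using K(1) pos_mod_sign[of "int K" k] by linarith
        define r where "r = nat (k mod int K)"
        have r: "int r = k mod int K" "0 < r"
          unfolding r_def using pos by linarith+
        have "(h \<otimes> h0 [^] (- q)) \<otimes> s [^] int r \<in> B"
          using y yB r by simp
        then have "K \<le> r"
          using hH r(2) by (intro K_min bexI)
        then show False
          using r(1) K(1) pos_mod_bound[of "int K" k] by linarith
      qed
      then have yH: "y \<in> B \<inter> ?H"
        using y yB hH H by auto
      have "x = y \<otimes> b [^] q"
        unfolding y_def using hc b by (simp add: int_pow_neg m_assoc)
      also have "b [^] q = b [^] (int n * (q div int n)) \<otimes> b [^] (q mod int n)"
        using b by (simp add: int_pow_mult[symmetric])
      also have "b [^] (int n * (q div int n)) = \<one>"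
        using b n by (simp add: int_pow_pow[symmetric] int_pow_int)
      finally have "x = y \<otimes> b [^] (q mod int n)" using b by simp
      then show "x \<in> (\<lambda>(x, i). x \<otimes> b [^] i) ` ((B \<inter> ?H) \<times> {0..<int n})"
        using yH n(1) by (intro image_eqI[of _ _ "(y, q mod int n)"]) auto
    qed
    then show ?thesis
      using fin by (auto intro: finite_subset)
  qed
qed

text \<open>The homomorphism from integer coefficient vectors onto the group generated by a finite
  S, in multiplicative notation. It allows linear algebra over the rationals on coefficients, with
  the relations of the group hidden in its kernel.\<close>

definition lincomb :: "'a set \<Rightarrow> ('a \<Rightarrow> int) \<Rightarrow> 'a" where
  "lincomb S c = finprod G (\<lambda>s. s [^] c s) S"

lemma lincomb_closed: "S \<subseteq> carrier G \<Longrightarrow> lincomb S c \<in> carrier G"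
  unfolding lincomb_def by (intro finprod_closed) auto

lemma lincomb_add:
  "S \<subseteq> carrier G \<Longrightarrow> lincomb S (\<lambda>s. c s + d s) = lincomb S c \<otimes> lincomb S d"
  unfolding lincomb_def
  by (subst finprod_multf[symmetric]) (auto simp: int_pow_mult intro!: finprod_cong')

lemma lincomb_cong:
  assumes "S \<subseteq> carrier G" "\<And>s. s \<in> S \<Longrightarrow> c s = d s"
  shows "lincomb S c = lincomb S d"
  unfolding lincomb_def using assms by (auto intro!: finprod_cong')

lemma lincomb_zero: "lincomb S (\<lambda>_. 0) = \<one>"
  unfolding lincomb_def by (simp add: finprod_one)

lemma lincomb_uminus:
  assumes "S \<subseteq> carrier G"
  shows "lincomb S (\<lambda>s. - c s) = inv (lincomb S c)"
proof (rule inv_equality[symmetric])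
  show "lincomb S (\<lambda>s. - c s) \<otimes> lincomb S c = \<one>"
    using lincomb_add[OF assms, of "\<lambda>s. - c s" c] by (simp add: lincomb_zero)
qed (use assms in \<open>simp_all add: lincomb_closed\<close>)

lemma lincomb_scale:
  assumes "S \<subseteq> carrier G"
  shows "lincomb S (\<lambda>s. k * c s) = lincomb S c [^] k"
proof -
  have nat: "lincomb S (\<lambda>s. int n * c s) = lincomb S c [^] n" for n
  proof (induction n)
    case 0
    then show ?case by (simp add: lincomb_zero)
  next
    case (Suc n)
    have "lincomb S (\<lambda>s. int (Suc n) * c s) = lincomb S (\<lambda>s. int n * c s + c s)"
      by (simp add: algebra_simps)
    then show ?case using Suc by (simp add: lincomb_add[OF assms])
  qed
  show ?thesis
  proof (cases "k \<ge> 0")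
    case True
    then show ?thesis using nat[of "nat k"] by (metis int_nat_eq int_pow_int)
  next
    case False
    then obtain n where "k = - int n" by (metis int_cases2 of_nat_0_le_iff)
    then show ?thesis
      using nat[of n] lincomb_uminus[OF assms, of "\<lambda>s. int n * c s"]
      by (simp add: int_pow_neg_int lincomb_closed assms)
  qed
qed

lemma generate_lincomb:
  assumes "finite S" "S \<subseteq> carrier G" "x \<in> generate G S"
  shows "\<exists>c. x = lincomb S c"
  using assms(3)
proof (induction rule: generate.induct)
  case one
  then show ?case by (metis lincomb_zero)
next
  case (incl h)
  have "lincomb S (\<lambda>s. if h = s then 1 else 0) = finprod G (\<lambda>s. if h = s then s else \<one>) S"
    unfolding lincomb_def using assms(2) by (intro finprod_cong') auto
  also have "\<dots> = h"
    using assms incl by (subst finprod_singleton) auto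
  finally show ?case by metis
next
  case (inv h)
  have "lincomb S (\<lambda>s. if h = s then 1 else 0) = finprod G (\<lambda>s. if h = s then s else \<one>) S"
    unfolding lincomb_def using assms(2) by (intro finprod_cong') auto
  also have "\<dots> = h"
    using assms inv by (subst finprod_singleton) auto
  finally show ?case
    using lincomb_uminus[OF assms(2)] by metis
next
  case (eng h1 h2)
  then show ?case by (metis lincomb_add[OF assms(2)])
qed

text \<open>The quotient by D is finitely generated and torsion-free, so homomorphisms to the
  integers separate its points. Instead of a basis of the quotient, a rational functional on
  coefficient vectors is used: it vanishes on the span of the vectors representing D and not at b,
  and finitely many denominators are cleared at the end.\<close>

lemma integer_hom_separating:
  assumes S: "finite S" "S \<subseteq> carrier G" "generate G S = carrier G"
    and D: "subgroup D G"
    and pure: "\<And>x n. x \<in> carrier G \<Longrightarrow> 0 < n \<Longrightarrow> x [^] (n::nat) \<in> D \<Longrightarrow> x \<in> D"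
    and b: "b \<in> carrier G" "b \<notin> D"
  shows "\<exists>\<rho> :: 'a \<Rightarrow> int. (\<forall>x\<in>carrier G. \<forall>y\<in>carrier G. \<rho> (x \<otimes> y) = \<rho> x + \<rho> y) \<and>
    (\<forall>x\<in>D. \<rho> x = 0) \<and> \<rho> b \<noteq> 0"
proof -
  interpret D: subgroup D G by fact
  let ?L = "lincomb S"
  \<comment> \<open>The rational span of the coefficient vectors of elements of D. It contains all
    relations among the generators, because the neutral element lies in D, and all vectors vanishing
    on S.\<close>
  define V where "V = {v :: 'a \<Rightarrow> rat. \<exists>N c. 0 < N \<and> (\<forall>s\<in>S. of_int N * v s = of_int (c s)) \<and> ?L c \<in> D}"
  \<comment> \<open>The chosen coefficients need not be additive in x; the defect is a relation and
    so lies in V.\<close>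
  define co where "co x = (SOME c. x = ?L c)" for x
  have co: "?L (co x) = x" if "x \<in> carrier G" for x
    using someI_ex[OF generate_lincomb[of S x]] S that unfolding co_def by metis
  let ?q = "\<lambda>c::'a \<Rightarrow> int. \<lambda>s. of_int (c s) :: rat"
  have in_V: "?q c \<in> V" if "?L c \<in> D" for c
    unfolding V_def using that by (auto intro!: exI[of _ 1] exI[of _ c])
  have V0: "(\<lambda>s. 0) \<in> V"
    using in_V[of "\<lambda>_. 0"] by (simp add: lincomb_zero)
  have V_add: "(\<lambda>s. v s + w s) \<in> V" if vw: "v \<in> V" "w \<in> V" for v w
  proof -
    obtain M c where M: "0 < M" "\<forall>s\<in>S. of_int M * v s = of_int (c s)" "?L c \<in> D"
      using vw(1) unfolding V_def by blast
    obtain N d where N: "0 < N" "\<forall>s\<in>S. of_int N * w s = of_int (d s)" "?L d \<in> D"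
      using vw(2) unfolding V_def by blast
    have "of_int (M * N) * (v s + w s) = of_int (N * c s + M * d s)" if "s \<in> S" for s
    proof -
      have "of_int (M * N) * (v s + w s) = of_int N * (of_int M * v s) + of_int M * (of_int N * w s)"
        by (simp add: algebra_simps)
      then show ?thesis using M N that by simp
    qed
    moreover have "?L (\<lambda>s. N * c s + M * d s) \<in> D"
      using M N S D by (simp add: lincomb_add lincomb_scale subgroup_int_pow_closed)
    ultimately show ?thesis
      unfolding V_def using M N by (auto intro!: exI[of _ "M * N"] exI[of _ "\<lambda>s. N * c s + M * d s"])
  qed
  have V_scale: "(\<lambda>s. r * v s) \<in> V" if v: "v \<in> V" for r v
  proof -
    obtain M c where M: "0 < M" "\<forall>s\<in>S. of_int M * v s = of_int (c s)" "?L c \<in> D"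
      using v unfolding V_def by blast
    obtain p q where "quotient_of r = (p, q)"
      by (cases "quotient_of r")
    then have r: "r = of_int p / of_int q" and q: "0 < q"
      using quotient_of_div quotient_of_denom_pos by blast+
    have "of_int (q * M) * (r * v s) = of_int (p * c s)" if "s \<in> S" for s
    proof -
      have "of_int (q * M) * (r * v s) = of_int p * (of_int M * v s)"
        using q by (simp add: r)
      then show ?thesis using M that by simp
    qed
    moreover have "?L (\<lambda>s. p * c s) \<in> D"
      using M S D by (simp add: lincomb_scale subgroup_int_pow_closed)
    ultimately show ?thesis
      unfolding V_def using M q by (auto intro!: exI[of _ "q * M"] exI[of _ "\<lambda>s. p * c s"])
  qed
  \<comment> \<open>Membership would put a positive power of b into D, and purity would then give b
    itself.\<close>
  have e: "?q (co b) \<notin> V"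
  proof
    assume "?q (co b) \<in> V"
    then obtain N c where N: "0 < N" "\<forall>s\<in>S. of_int N * ?q (co b) s = of_int (c s)" "?L c \<in> D"
      unfolding V_def by blast
    then have "\<forall>s\<in>S. N * co b s = c s"
      by (metis of_int_eq_iff of_int_mult)
    then have "?L c = ?L (\<lambda>s. N * co b s)"
      using S by (intro lincomb_cong) auto
    also have "\<dots> = b [^] N"
      using S b by (simp add: lincomb_scale co)
    also have "\<dots> = b [^] nat N"
      using N(1) by (metis int_nat_eq int_pow_int less_imp_le)
    finally show False
      using pure[of b "nat N"] b N by simp
  qed
  obtain \<chi> :: "('a \<Rightarrow> rat) \<Rightarrow> rat" where \<chi>: "\<And>x y. \<chi> (\<lambda>i. x i + y i) = \<chi> x + \<chi> y"
    "\<And>r x. \<chi> (\<lambda>i. r * x i) = r * \<chi> x" "\<And>x. x \<in> V \<Longrightarrow> \<chi> x = 0" "\<chi> (?q (co b)) = 1"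
    using rational_functional_separating[OF V0 V_add V_scale e] by blast
  have \<chi>_eq: "\<chi> (?q c) = \<chi> (?q d) + \<chi> (?q c')" if "?L c \<otimes> inv (?L d \<otimes> ?L c') \<in> D" for c d c'
  proof -
    have "?L (\<lambda>s. c s + - (d s + c' s)) \<in> D"
      using that S by (simp only: lincomb_add lincomb_uminus)
    from \<chi>(3)[OF in_V[OF this]] have "\<chi> (\<lambda>s. ?q c s + (-1) * (?q d s + ?q c' s)) = 0"
      by simp
    then show ?thesis
      unfolding \<chi>(1) \<chi>(2) by simp
  qed
  define \<mu> where "\<mu> x = \<chi> (?q (co x))" for x
  have \<mu>_add: "\<mu> (x \<otimes> y) = \<mu> x + \<mu> y" if "x \<in> carrier G" "y \<in> carrier G" for x y
    unfolding \<mu>_def using that by (intro \<chi>_eq) (simp add: co)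
  have \<mu>_D: "\<mu> x = 0" if "x \<in> D" for x
    unfolding \<mu>_def using that by (intro \<chi>(3) in_V) (simp add: co)
  have \<mu>_one: "\<mu> \<one> = 0"
    by (rule \<mu>_D) simp
  have \<mu>_inv: "\<mu> (inv x) = - \<mu> x" if "x \<in> carrier G" for x
    using \<mu>_add[of "inv x" x] \<mu>_one that by simp
  obtain Q :: int where Q: "0 < Q" "\<forall>s\<in>S. of_int Q * \<mu> s \<in> \<int>"
    using common_denominator[OF S(1)] by blast
  have Q_int: "of_int Q * \<mu> x \<in> \<int>" if "x \<in> generate G S" for x
    using that
  proof (induction rule: generate.induct)
    case one
    then show ?case by (simp add: \<mu>_one)
  next
    case (incl h)
    then show ?case using Q by blast
  next
    case (inv h)
    then show ?case using Q S \<mu>_inv[of h] by (auto simp: subset_iff)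
  next
    case (eng h1 h2)
    then show ?case using S \<mu>_add[of h1 h2] by (simp add: distrib_left)
  qed
  \<comment> \<open>After multiplication by Q the values are integers, so the floor is only a type
    conversion.\<close>
  have fl: "of_int \<lfloor>of_int Q * \<mu> x\<rfloor> = of_int Q * \<mu> x" if "x \<in> carrier G" for x
    using Q_int[of x] S that by (auto elim!: Ints_cases)
  show ?thesis
  proof (intro exI[of _ "\<lambda>x. \<lfloor>of_int Q * \<mu> x\<rfloor>"] conjI ballI)
    fix x y assume xy: "x \<in> carrier G" "y \<in> carrier G"
    have "of_int \<lfloor>of_int Q * \<mu> (x \<otimes> y)\<rfloor> = (of_int (\<lfloor>of_int Q * \<mu> x\<rfloor> + \<lfloor>of_int Q * \<mu> y\<rfloor>) :: rat)"
      unfolding of_int_add fl[OF xy(1)] fl[OF xy(2)] fl[OF m_closed[OF xy]]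
      unfolding \<mu>_add[OF xy] by (rule distrib_left)
    then show "\<lfloor>of_int Q * \<mu> (x \<otimes> y)\<rfloor> = \<lfloor>of_int Q * \<mu> x\<rfloor> + \<lfloor>of_int Q * \<mu> y\<rfloor>"
      by (simp only: of_int_eq_iff)
  next
    show "\<lfloor>of_int Q * \<mu> b\<rfloor> \<noteq> 0"
      using Q(1) \<chi>(4) by (simp add: \<mu>_def)
  qed (simp add: \<mu>_D)
qed

end

section \<open>Automorphisms of ultrapowers and definable sets\<close>

locale ultrafilter =
  fixes U :: "'i filter"
  assumes nontrivial: "U \<noteq> bot"
    and ultra: "eventually P U \<or> eventually (\<lambda>i. \<not> P i) U"
begin

abbreviation almost_all :: "('i \<Rightarrow> bool) \<Rightarrow> bool" where
  "almost_all P \<equiv> eventually P U"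

text \<open>Pairs a statement about elements of the ultrapower with the statement about their
  images. The closure rules below prove invariance of a property by following its shape, so that
  properties such as divisibility or coding need not be written out as formulas.\<close>

definition same_truth :: "('i \<Rightarrow> bool) \<Rightarrow> ('i \<Rightarrow> bool) \<Rightarrow> bool" where
  "same_truth P Q \<longleftrightarrow> (almost_all P \<longleftrightarrow> almost_all Q)"

lemma almost_all_not: "almost_all (\<lambda>i. \<not> P i) \<longleftrightarrow> \<not> almost_all P"
proof
  assume "almost_all (\<lambda>i. \<not> P i)"
  show "\<not> almost_all P"
  proof
    assume "almost_all P"
    then have "almost_all (\<lambda>i. False)"
      using \<open>almost_all (\<lambda>i. \<not> P i)\<close> by eventually_elim simp
    then show False using nontrivial by (simp add: trivial_limit_def)
  qed
qed (use ultra in blast)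

lemma almost_all_const [simp]: "almost_all (\<lambda>_. P) \<longleftrightarrow> P"
  using nontrivial by (simp add: eventually_const)

lemma same_truth_not: "same_truth P Q \<Longrightarrow> same_truth (\<lambda>i. \<not> P i) (\<lambda>i. \<not> Q i)"
  by (simp add: same_truth_def almost_all_not)

lemma same_truth_conj:
  "same_truth P Q \<Longrightarrow> same_truth P' Q' \<Longrightarrow> same_truth (\<lambda>i. P i \<and> P' i) (\<lambda>i. Q i \<and> Q' i)"
  by (simp add: same_truth_def eventually_conj_iff)

lemma same_truth_disj:
  assumes "same_truth P Q" "same_truth P' Q'"
  shows "same_truth (\<lambda>i. P i \<or> P' i) (\<lambda>i. Q i \<or> Q' i)"
proof -
  have "same_truth (\<lambda>i. \<not> (\<not> P i \<and> \<not> P' i)) (\<lambda>i. \<not> (\<not> Q i \<and> \<not> Q' i))"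
    using assms by (intro same_truth_not same_truth_conj)
  then show ?thesis
    by (simp only: de_Morgan_conj not_not)
qed

lemma same_truth_imp:
  assumes "same_truth P Q" "same_truth P' Q'"
  shows "same_truth (\<lambda>i. P i \<longrightarrow> P' i) (\<lambda>i. Q i \<longrightarrow> Q' i)"
  unfolding imp_conv_disj by (intro same_truth_disj same_truth_not assms)

lemma same_truth_const: "same_truth (\<lambda>_. P) (\<lambda>_. P)"
  by (simp add: same_truth_def)

lemma same_truth_cong:
  "same_truth P Q \<Longrightarrow> almost_all (\<lambda>i. P i = P' i) \<Longrightarrow> almost_all (\<lambda>i. Q i = Q' i) \<Longrightarrow> same_truth P' Q'"
  unfolding same_truth_def by (metis eventually_subst)

lemma same_truth_all_less:
  "(\<And>j. j < (m::nat) \<Longrightarrow> same_truth (\<lambda>i. P i j) (\<lambda>i. Q i j)) \<Longrightarrow>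
    same_truth (\<lambda>i. \<forall>j<m. P i j) (\<lambda>i. \<forall>j<m. Q i j)"
  by (induction m) (simp_all add: same_truth_const All_less_Suc same_truth_conj)

end

text \<open>Representatives of elements of the ultrapower. Membership is asked at every index, not
  just almost every one, so that closure under operations is pointwise.\<close>

definition internal :: "'a set \<Rightarrow> ('i \<Rightarrow> 'a) set" where
  "internal S = {x. \<forall>i. x i \<in> S}"

lemma internalI: "(\<And>i. x i \<in> S) \<Longrightarrow> x \<in> internal S"
  and internalD: "x \<in> internal S \<Longrightarrow> x i \<in> S"
  by (auto simp: internal_def)

abbreviation at_index :: "'i \<Rightarrow> ('i \<Rightarrow> 'a) list \<Rightarrow> 'a list" where
  "at_index i xs \<equiv> map (\<lambda>x. x i) xs"

text \<open>The quantifier step of the theorem of Los: witnesses are chosen index by index, and an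
  element of the nonempty S fills the indices without one.\<close>

lemma (in ultrafilter) almost_all_bex:
  assumes "S \<noteq> {}"
  shows "almost_all (\<lambda>i. \<exists>a\<in>S. P i a) \<longleftrightarrow> (\<exists>x\<in>internal S. almost_all (\<lambda>i. P i (x i)))" (is "?L \<longleftrightarrow> ?R")
proof
  assume ?L
  obtain c where "c \<in> S" using assms by blast
  define x where "x i = (if \<exists>a\<in>S. P i a then SOME a. a \<in> S \<and> P i a else c)" for i
  have x: "x i \<in> S \<and> ((\<exists>a\<in>S. P i a) \<longrightarrow> P i (x i))" for i
  proof (cases "\<exists>a\<in>S. P i a")
    case True
    then have "\<exists>a. a \<in> S \<and> P i a" by blast
    from someI_ex[OF this] show ?thesis using True by (simp add: x_def)
  qed (simp add: x_def \<open>c \<in> S\<close>)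
  from \<open>?L\<close> have "almost_all (\<lambda>i. P i (x i))"
    by (rule eventually_mono) (use x in blast)
  then show ?R
    using x by (intro bexI[of _ x]) (auto intro: internalI)
next
  assume ?R
  then obtain x where x: "x \<in> internal S" "almost_all (\<lambda>i. P i (x i))" by blast
  from x(2) show ?L
    by eventually_elim (use internalD[OF x(1)] in blast)
qed

lemma (in ultrafilter) almost_all_map_cong:
  assumes "\<And>x. x \<in> set xs \<Longrightarrow> almost_all (\<lambda>i. p x i = q x i)"
  shows "almost_all (\<lambda>i. map (\<lambda>x. p x i) xs = map (\<lambda>x. q x i) xs)"
proof -
  have "almost_all (\<lambda>i. \<forall>x\<in>set xs. p x i = q x i)"
    using assms by (intro eventually_ball_finite) auto
  then show ?thesis by eventually_elim auto
qed

text \<open>An automorphism of the ultrapower fixing M pointwise, expressed on representatives: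
  \<open>\<sigma>_eq_iff\<close> says both that \<sigma> is well defined on classes and that it is
  injective there.\<close>

locale ultrapower_automorphism = ultrafilter U
  for U :: "'i filter" +
  fixes M :: "('f, 'r, 'a) fo_structure" and \<sigma> :: "('i \<Rightarrow> 'a) \<Rightarrow> 'i \<Rightarrow> 'a"
  assumes fun_of_closed:
      "fun_ar M h = Some (length as) \<Longrightarrow> set as \<subseteq> univ M \<Longrightarrow> fun_of M h as \<in> univ M"
    and \<sigma>_closed: "x \<in> internal (univ M) \<Longrightarrow> \<sigma> x \<in> internal (univ M)"
    and \<sigma>_eq_iff: "x \<in> internal (univ M) \<Longrightarrow> y \<in> internal (univ M) \<Longrightarrow>
      almost_all (\<lambda>i. \<sigma> x i = \<sigma> y i) \<longleftrightarrow> almost_all (\<lambda>i. x i = y i)"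
    and \<sigma>_surj: "y \<in> internal (univ M) \<Longrightarrow> \<exists>x\<in>internal (univ M). almost_all (\<lambda>i. \<sigma> x i = y i)"
    and \<sigma>_const: "c \<in> univ M \<Longrightarrow> almost_all (\<lambda>i. \<sigma> (\<lambda>_. c) i = c)"
    and \<sigma>_fun_of: "fun_ar M h = Some (length xs) \<Longrightarrow> set xs \<subseteq> internal (univ M) \<Longrightarrow>
      almost_all (\<lambda>i. \<sigma> (\<lambda>j. fun_of M h (at_index j xs)) i = fun_of M h (at_index i (map \<sigma> xs)))"
    and \<sigma>_rel_of: "rel_ar M r = Some (length xs) \<Longrightarrow> set xs \<subseteq> internal (univ M) \<Longrightarrow>
      almost_all (\<lambda>i. rel_of M r (at_index i (map \<sigma> xs))) \<longleftrightarrow> almost_all (\<lambda>i. rel_of M r (at_index i xs))"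
begin

lemma eval_term_closed:
  "wf_term M (length e) t \<Longrightarrow> set e \<subseteq> univ M \<Longrightarrow> eval_term M e t \<in> univ M"
proof (induction t)
  case (Var x)
  then show ?case by (auto simp: subset_iff)
next
  case (App h ts)
  then show ?case
    by (auto simp: list_all_iff intro!: fun_of_closed)
qed

lemma eval_term_internal:
  assumes "wf_term M (length es) t" "set es \<subseteq> internal (univ M)"
  shows "(\<lambda>i. eval_term M (at_index i es) t) \<in> internal (univ M)"
  using assms by (intro internalI eval_term_closed) (auto intro: internalD)

lemma \<sigma>_eval_term:
  assumes "set es \<subseteq> internal (univ M)"
  shows "wf_term M (length es) t \<Longrightarrow>
    almost_all (\<lambda>i. \<sigma> (\<lambda>j. eval_term M (at_index j es) t) i = eval_term M (at_index i (map \<sigma> es)) t)"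
proof (induction t)
  case (Var x)
  then show ?case by simp
next
  case (App h ts)
  let ?xs = "map (\<lambda>t j. eval_term M (at_index j es) t) ts"
  have wf: "wf_term M (length es) t" if "t \<in> set ts" for t
    using App.prems that by (auto simp: list_all_iff)
  have "almost_all (\<lambda>i. \<sigma> (\<lambda>j. fun_of M h (at_index j ?xs)) i = fun_of M h (at_index i (map \<sigma> ?xs)))"
  proof (rule \<sigma>_fun_of)
    show "fun_ar M h = Some (length ?xs)" using App.prems by simp
    show "set ?xs \<subseteq> internal (univ M)"
      using eval_term_internal[OF wf assms] by auto
  qed
  moreover have "almost_all (\<lambda>i. map (\<lambda>t. \<sigma> (\<lambda>j. eval_term M (at_index j es) t) i) ts =
      map (\<lambda>t. eval_term M (at_index i (map \<sigma> es)) t) ts)"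
    using App.IH wf by (intro almost_all_map_cong) blast
  ultimately show ?case
    by eventually_elim (simp add: comp_def)
qed

text \<open>Automorphisms preserve satisfaction, combined with the theorem of Los in a single
  induction. In the existential case a witness for the image is pulled back by surjectivity of
  \<sigma>.\<close>

lemma \<sigma>_sat:
  "wf_formula M (length es) \<phi> \<Longrightarrow> set es \<subseteq> internal (univ M) \<Longrightarrow>
    almost_all (\<lambda>i. sat M (at_index i (map \<sigma> es)) \<phi>) \<longleftrightarrow> almost_all (\<lambda>i. sat M (at_index i es) \<phi>)"
proof (induction \<phi> arbitrary: es)
  case (Eq s t)
  let ?s = "\<lambda>j. eval_term M (at_index j es) s" and ?t = "\<lambda>j. eval_term M (at_index j es) t"
  have wf: "wf_term M (length es) s" "wf_term M (length es) t"
    using Eq.prems by auto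
  have "almost_all (\<lambda>i. (\<sigma> ?s i = \<sigma> ?t i) =
      (eval_term M (at_index i (map \<sigma> es)) s = eval_term M (at_index i (map \<sigma> es)) t))"
    using \<sigma>_eval_term[of es s] \<sigma>_eval_term[of es t] Eq.prems(2) wf
    by (auto elim: eventually_elim2)
  then have "almost_all (\<lambda>i. \<sigma> ?s i = \<sigma> ?t i) \<longleftrightarrow>
      almost_all (\<lambda>i. eval_term M (at_index i (map \<sigma> es)) s = eval_term M (at_index i (map \<sigma> es)) t)"
    by (rule eventually_subst)
  moreover have "almost_all (\<lambda>i. \<sigma> ?s i = \<sigma> ?t i) \<longleftrightarrow> almost_all (\<lambda>i. ?s i = ?t i)"
    using wf Eq.prems(2) by (intro \<sigma>_eq_iff eval_term_internal)
  ultimately show ?case by simp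
next
  case (Rel r ts)
  let ?xs = "map (\<lambda>t j. eval_term M (at_index j es) t) ts"
  have wf: "wf_term M (length es) t" if "t \<in> set ts" for t
    using Rel.prems that by (auto simp: list_all_iff)
  have "almost_all (\<lambda>i. rel_of M r (at_index i (map \<sigma> ?xs))) \<longleftrightarrow> almost_all (\<lambda>i. rel_of M r (at_index i ?xs))"
  proof (rule \<sigma>_rel_of)
    show "rel_ar M r = Some (length ?xs)" using Rel.prems by simp
    show "set ?xs \<subseteq> internal (univ M)"
      using eval_term_internal[OF wf Rel.prems(2)] by auto
  qed
  moreover have "almost_all (\<lambda>i. map (\<lambda>t. \<sigma> (\<lambda>j. eval_term M (at_index j es) t) i) ts =
      map (\<lambda>t. eval_term M (at_index i (map \<sigma> es)) t) ts)"
    using Rel.prems(2) wf by (intro almost_all_map_cong \<sigma>_eval_term)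
  then have "almost_all (\<lambda>i. rel_of M r (at_index i (map \<sigma> ?xs)) = sat M (at_index i (map \<sigma> es)) (Rel r ts))"
    by eventually_elim (simp add: comp_def cong: map_cong)
  then have "almost_all (\<lambda>i. rel_of M r (at_index i (map \<sigma> ?xs))) \<longleftrightarrow>
      almost_all (\<lambda>i. sat M (at_index i (map \<sigma> es)) (Rel r ts))"
    by (rule eventually_subst)
  ultimately show ?case by (simp add: comp_def)
next
  case (Neg \<phi>)
  then show ?case by (simp add: almost_all_not)
next
  case (Conj \<phi> \<psi>)
  then show ?case by (simp add: eventually_conj_iff)
next
  case (Exists \<phi>)
  have IH: "almost_all (\<lambda>i. sat M (\<sigma> x i # at_index i (map \<sigma> es)) \<phi>) \<longleftrightarrow>
      almost_all (\<lambda>i. sat M (x i # at_index i es) \<phi>)" if "x \<in> internal (univ M)" for x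
    using Exists.IH[of "x # es"] Exists.prems that by auto
  show ?case
  proof (cases "univ M = {}")
    case False
    have "(\<exists>x\<in>internal (univ M). almost_all (\<lambda>i. sat M (x i # at_index i (map \<sigma> es)) \<phi>)) \<longleftrightarrow>
        (\<exists>x\<in>internal (univ M). almost_all (\<lambda>i. sat M (x i # at_index i es) \<phi>))" (is "?L \<longleftrightarrow> ?R")
    proof
      assume ?R
      then show ?L using IH \<sigma>_closed by blast
    next
      assume ?L
      then obtain y where y: "y \<in> internal (univ M)" "almost_all (\<lambda>i. sat M (y i # at_index i (map \<sigma> es)) \<phi>)"
        by blast
      obtain x where x: "x \<in> internal (univ M)" "almost_all (\<lambda>i. \<sigma> x i = y i)"
        using \<sigma>_surj[OF y(1)] by blast
      have "almost_all (\<lambda>i. sat M (\<sigma> x i # at_index i (map \<sigma> es)) \<phi>)"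
        using y(2) x(2) by eventually_elim simp
      then show ?R using IH x(1) by blast
    qed
    then show ?thesis
      using False by (simp add: almost_all_bex)
  qed simp
qed

text \<open>Parameters enter as constant sequences, which \<sigma> fixes up to a null set; this is
  why \<sigma> must fix all of M.\<close>

lemma definable_invariant:
  assumes "definable M k X" "length xs = k" "set xs \<subseteq> internal (univ M)"
  shows "almost_all (\<lambda>i. at_index i (map \<sigma> xs) \<in> X) \<longleftrightarrow> almost_all (\<lambda>i. at_index i xs \<in> X)"
proof -
  obtain \<phi> ps where ps: "set ps \<subseteq> univ M" and wf: "wf_formula M (k + length ps) \<phi>"
    and X: "X = {as \<in> tuples (univ M) k. sat M (as @ ps) \<phi>}"
    using assms(1) unfolding definable_def by blast
  let ?es = "xs @ map (\<lambda>c _. c) ps"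
  have tup: "at_index i xs \<in> tuples (univ M) k" "at_index i (map \<sigma> xs) \<in> tuples (univ M) k" for i
    using assms unfolding tuples_def by (auto intro: internalD \<sigma>_closed)
  have \<sigma>_es: "almost_all (\<lambda>i. sat M (at_index i (map \<sigma> ?es)) \<phi>) \<longleftrightarrow> almost_all (\<lambda>i. sat M (at_index i ?es) \<phi>)"
  proof (rule \<sigma>_sat)
    show "wf_formula M (length ?es) \<phi>"
      using wf assms(2) by simp
    show "set ?es \<subseteq> internal (univ M)"
      using assms(3) ps by (auto intro: internalI)
  qed
  have es: "(\<lambda>i. sat M (at_index i ?es) \<phi>) = (\<lambda>i. at_index i xs \<in> X)"
  proof
    fix i show "sat M (at_index i ?es) \<phi> \<longleftrightarrow> at_index i xs \<in> X"
      using tup(1)[of i] by (simp add: X comp_def)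
  qed
  have "almost_all (\<lambda>i. map (\<lambda>c. \<sigma> (\<lambda>_. c) i) ps = map (\<lambda>c. c) ps)"
    using ps by (intro almost_all_map_cong \<sigma>_const) auto
  then have "almost_all (\<lambda>i. sat M (at_index i (map \<sigma> ?es)) \<phi> = (at_index i (map \<sigma> xs) \<in> X))"
  proof eventually_elim
    case (elim i)
    then show ?case using tup(2)[of i] by (simp add: X comp_def)
  qed
  then have "almost_all (\<lambda>i. sat M (at_index i (map \<sigma> ?es)) \<phi>) \<longleftrightarrow> almost_all (\<lambda>i. at_index i (map \<sigma> xs) \<in> X)"
    by (rule eventually_subst)
  from trans[OF this[symmetric] \<sigma>_es] show ?thesis
    unfolding es .
qed

end

section \<open>Transport along an interpretation of the integers\<close>

text \<open>Definable sets consist of flat tuples, so the blocks of an interpretation have to be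
  recovered from their concatenation.\<close>

lemma concat_inject:
  assumes "length xss = length yss" "\<And>xs. xs \<in> set xss \<union> set yss \<Longrightarrow> length xs = n"
    "concat xss @ as = concat yss @ bs"
  shows "xss = yss \<and> as = bs"
  using assms
  by (induction xss yss rule: list_induct2) auto

text \<open>The interpretation \<open>f\<close> transports \<open>\<sigma>\<close> to an automorphism \<open>\<tau>\<close> of the ultrapower of
  the integers, computed on representatives.\<close>

locale interpreted_integers = ultrapower_automorphism U M \<sigma>
  for U :: "'i filter" and M :: "('f, 'r, 'a) fo_structure" and \<sigma> +
  fixes dim :: nat and D :: "'a list set" and f :: "'a list \<Rightarrow> int"
  assumes interp: "interpretation_in (ring_structure \<Z>) M dim D f"
begin

definition rep :: "int \<Rightarrow> 'a list" where
  "rep z = (SOME xs. xs \<in> D \<and> f xs = z)"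

lemma rep: "rep z \<in> D" "f (rep z) = z"
proof -
  have "z \<in> f ` D"
    using interp by (simp add: interpretation_in_def ring_structure_def)
  then have "\<exists>xs. xs \<in> D \<and> f xs = z" by blast
  from someI_ex[OF this] show "rep z \<in> D" "f (rep z) = z"
    by (auto simp: rep_def)
qed

lemma D_subset: "xs \<in> D \<Longrightarrow> length xs = dim \<and> set xs \<subseteq> univ M"
  using interp unfolding interpretation_in_def definable_def tuples_def by auto

definition reps :: "('i \<Rightarrow> int) \<Rightarrow> ('i \<Rightarrow> 'a) list" where
  "reps k = map (\<lambda>j i. rep (k i) ! j) [0..<dim]"

lemma length_reps [simp]: "length (reps k) = dim"
  by (simp add: reps_def)

lemma at_index_reps [simp]: "at_index i (reps k) = rep (k i)"
  using D_subset[OF rep(1)[of "k i"]] by (auto simp: reps_def intro!: nth_equalityI)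

lemma reps_internal: "set (reps k) \<subseteq> internal (univ M)"
proof -
  have "rep z ! j \<in> univ M" if "j < dim" for z j
    using D_subset[OF rep(1)[of z]] that by (metis nth_mem subset_iff)
  then show ?thesis
    by (auto simp: reps_def intro: internalI)
qed

text \<open>Coordinates of k are moved by \<sigma> and read off with f. Where the moved tuple leaves
  D the value is meaningless, but this happens only on a null set.\<close>

definition \<tau> :: "('i \<Rightarrow> int) \<Rightarrow> 'i \<Rightarrow> int" where
  "\<tau> k i = f (at_index i (map \<sigma> (reps k)))"

lemma \<sigma>_D_iff:
  assumes "length xs = dim" "set xs \<subseteq> internal (univ M)"
  shows "almost_all (\<lambda>i. at_index i (map \<sigma> xs) \<in> D) \<longleftrightarrow> almost_all (\<lambda>i. at_index i xs \<in> D)"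
  using interp assms unfolding interpretation_in_def by (intro definable_invariant) auto

lemma almost_all_\<sigma>_reps_in_D: "almost_all (\<lambda>i. at_index i (map \<sigma> (reps k)) \<in> D)"
  using \<sigma>_D_iff[OF length_reps reps_internal] by (simp only: at_index_reps rep almost_all_const)

text \<open>Invariance of the definable kernel of f. Membership in D is kept on both sides, as f is
  unconstrained outside D.\<close>

lemma \<sigma>_f_eq_iff:
  assumes "length xs = dim" "set xs \<subseteq> internal (univ M)"
    "length ys = dim" "set ys \<subseteq> internal (univ M)"
  shows "almost_all (\<lambda>i. at_index i (map \<sigma> xs) \<in> D \<and> at_index i (map \<sigma> ys) \<in> D \<and>
        f (at_index i (map \<sigma> xs)) = f (at_index i (map \<sigma> ys))) \<longleftrightarrow>
      almost_all (\<lambda>i. at_index i xs \<in> D \<and> at_index i ys \<in> D \<and> f (at_index i xs) = f (at_index i ys))"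
proof -
  let ?X = "{xs @ ys | xs ys. xs \<in> D \<and> ys \<in> D \<and> f xs = f ys}"
  have X: "as @ bs \<in> ?X \<longleftrightarrow> as \<in> D \<and> bs \<in> D \<and> f as = f bs" if "length as = dim" for as bs
  proof
    assume "as @ bs \<in> ?X"
    then obtain xs ys where *: "as @ bs = xs @ ys" "xs \<in> D" "ys \<in> D" "f xs = f ys"
      by blast
    then have "as = xs \<and> bs = ys"
      using that D_subset[of xs] append_eq_append_conv[of as xs bs ys] by simp
    then show "as \<in> D \<and> bs \<in> D \<and> f as = f bs"
      using * by simp
  qed blast
  have "definable M (dim + dim) ?X"
    using interp unfolding interpretation_in_def by blast
  then have "almost_all (\<lambda>i. at_index i (map \<sigma> (xs @ ys)) \<in> ?X) \<longleftrightarrow> almost_all (\<lambda>i. at_index i (xs @ ys) \<in> ?X)"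
    by (rule definable_invariant) (use assms in simp_all)
  then show ?thesis
    using assms by (simp only: map_append X length_map)
qed

text \<open>Independence of the coordinates: \<tau> is defined by the particular choice
  \<open>reps\<close>, but any other coordinates of k give the same class.\<close>

lemma \<tau>_eqI:
  assumes "length xs = dim" "set xs \<subseteq> internal (univ M)"
    "almost_all (\<lambda>i. at_index i xs \<in> D)" "almost_all (\<lambda>i. f (at_index i xs) = k i)"
  shows "almost_all (\<lambda>i. f (at_index i (map \<sigma> xs)) = \<tau> k i)"
proof -
  have "almost_all (\<lambda>i. at_index i xs \<in> D \<and> at_index i (reps k) \<in> D \<and> f (at_index i xs) = f (at_index i (reps k)))"
    using assms(3,4) by eventually_elim (simp add: rep)
  then have "almost_all (\<lambda>i. at_index i (map \<sigma> xs) \<in> D \<and> at_index i (map \<sigma> (reps k)) \<in> D \<and>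
        f (at_index i (map \<sigma> xs)) = f (at_index i (map \<sigma> (reps k))))"
    using \<sigma>_f_eq_iff[OF assms(1,2) length_reps reps_internal] by blast
  then show ?thesis
    by eventually_elim (simp only: \<tau>_def)
qed

lemma \<tau>_eq_iff: "almost_all (\<lambda>i. \<tau> k i = \<tau> l i) \<longleftrightarrow> almost_all (\<lambda>i. k i = l i)"
proof -
  have "almost_all (\<lambda>i. \<tau> k i = \<tau> l i) \<longleftrightarrow>
    almost_all (\<lambda>i. at_index i (map \<sigma> (reps k)) \<in> D \<and> at_index i (map \<sigma> (reps l)) \<in> D \<and>
        f (at_index i (map \<sigma> (reps k))) = f (at_index i (map \<sigma> (reps l))))"
    using almost_all_\<sigma>_reps_in_D[of k] almost_all_\<sigma>_reps_in_D[of l]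
    by (simp only: eventually_conj_iff \<tau>_def simp_thms)
  also have "\<dots> \<longleftrightarrow> almost_all (\<lambda>i. at_index i (reps k) \<in> D \<and> at_index i (reps l) \<in> D \<and>
      f (at_index i (reps k)) = f (at_index i (reps l)))"
    by (intro \<sigma>_f_eq_iff length_reps reps_internal)
  finally show ?thesis by (simp add: rep)
qed

lemma \<tau>_const: "almost_all (\<lambda>i. \<tau> (\<lambda>_. c) i = c)"
proof -
  have "almost_all (\<lambda>i. map (\<lambda>j. \<sigma> (\<lambda>_. rep c ! j) i) [0..<dim] = map (\<lambda>j. rep c ! j) [0..<dim])"
    using D_subset[OF rep(1)[of c]] by (intro almost_all_map_cong \<sigma>_const) (auto simp: subset_iff)
  then show ?thesis
  proof eventually_elim
    case (elim i)
    have "at_index i (map \<sigma> (reps (\<lambda>_. c))) = map (\<lambda>j. \<sigma> (\<lambda>_. rep c ! j) i) [0..<dim]"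
      by (simp add: reps_def comp_def)
    also have "\<dots> = rep c"
      unfolding elim using D_subset[OF rep(1)[of c]] by (auto intro!: nth_equalityI)
    finally show ?case by (simp only: \<tau>_def rep)
  qed
qed

text \<open>The pulled-back graph of the operation is definable. It contains the coordinates of k, l
  and their result at every index, hence the \<sigma>-images of these coordinates at almost every
  index.\<close>

lemma \<tau>_op:
  fixes k l :: "'i \<Rightarrow> int"
  defines "op h a b \<equiv> fun_of (ring_structure \<Z>) h [a, b]"
  shows "almost_all (\<lambda>i. \<tau> (\<lambda>i. op h (k i) (l i)) i = op h (\<tau> k i) (\<tau> l i))"
proof -
  let ?m = "\<lambda>i. op h (k i) (l i)"
  let ?X = "{concat xss @ ys | xss ys. xss \<in> tuples D 2 \<and> ys \<in> D \<and> fun_of (ring_structure \<Z>) h (map f xss) = f ys}"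
  let ?xs = "concat [reps k, reps l] @ reps ?m"
  have X: "concat [as, bs] @ cs \<in> ?X \<longleftrightarrow> as \<in> D \<and> bs \<in> D \<and> cs \<in> D \<and> op h (f as) (f bs) = f cs"
    if "length as = dim" "length bs = dim" "length cs = dim" for as bs cs
  proof
    assume "concat [as, bs] @ cs \<in> ?X"
    then obtain xss ys where *: "concat [as, bs] @ cs = concat xss @ ys" "xss \<in> tuples D 2" "ys \<in> D"
        "fun_of (ring_structure \<Z>) h (map f xss) = f ys"
      by blast
    then have "[as, bs] = xss \<and> cs = ys"
      using that D_subset by (intro concat_inject[where n = dim]) (auto simp: tuples_def)
    then show "as \<in> D \<and> bs \<in> D \<and> cs \<in> D \<and> op h (f as) (f bs) = f cs"
      using * by (auto simp: tuples_def op_def)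
  next
    assume "as \<in> D \<and> bs \<in> D \<and> cs \<in> D \<and> op h (f as) (f bs) = f cs"
    then show "concat [as, bs] @ cs \<in> ?X"
      by (intro CollectI exI[of _ "[as, bs]"] exI[of _ cs]) (auto simp: tuples_def op_def)
  qed
  have "fun_ar (ring_structure \<Z>) h = Some 2"
    by (simp add: ring_structure_def)
  then have "definable M (2 * dim + dim) ?X"
    using interp unfolding interpretation_in_def by blast
  then have "almost_all (\<lambda>i. at_index i (map \<sigma> ?xs) \<in> ?X) \<longleftrightarrow> almost_all (\<lambda>i. at_index i ?xs \<in> ?X)"
    by (rule definable_invariant) (use reps_internal in simp_all)
  moreover have "at_index i ?xs \<in> ?X" for i
  proof -
    have "at_index i ?xs = concat [rep (k i), rep (l i)] @ rep (?m i)"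
      by (simp only: map_append concat.simps append_Nil2 at_index_reps)
    then show ?thesis
      using X[of "rep (k i)" "rep (l i)" "rep (?m i)"] D_subset[OF rep(1)] by (simp only: rep)
  qed
  ultimately have "almost_all (\<lambda>i. at_index i (map \<sigma> ?xs) \<in> ?X)"
    by simp
  then show ?thesis
  proof eventually_elim
    case (elim i)
    have "at_index i (map \<sigma> ?xs) = concat [at_index i (map \<sigma> (reps k)), at_index i (map \<sigma> (reps l))] @
        at_index i (map \<sigma> (reps ?m))"
      by (simp only: map_append concat.simps append_Nil2)
    with elim show ?case
      using X[of "at_index i (map \<sigma> (reps k))" "at_index i (map \<sigma> (reps l))" "at_index i (map \<sigma> (reps ?m))"]
      by (simp only: \<tau>_def length_map length_reps)
  qed
qed

lemma \<tau>_add: "almost_all (\<lambda>i. \<tau> (\<lambda>i. k i + l i) i = \<tau> k i + \<tau> l i)"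
  using \<tau>_op[of Add k l] by (simp add: ring_structure_def)

lemma \<tau>_mult: "almost_all (\<lambda>i. \<tau> (\<lambda>i. k i * l i) i = \<tau> k i * \<tau> l i)"
  using \<tau>_op[of Mult k l] by (simp add: ring_structure_def)

text \<open>The coordinates of l are pulled back along \<sigma> one by one; invariance of D places
  the resulting tuple in D almost everywhere, and f of it is the preimage.\<close>

lemma \<tau>_surj: "\<exists>k. almost_all (\<lambda>i. \<tau> k i = l i)"
proof -
  have "\<forall>j<dim. \<exists>x\<in>internal (univ M). almost_all (\<lambda>i. \<sigma> x i = rep (l i) ! j)"
    using D_subset[OF rep(1)] by (intro allI impI \<sigma>_surj internalI) (metis nth_mem subset_iff)
  then obtain x where x: "\<And>j. j < dim \<Longrightarrow> x j \<in> internal (univ M)"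
      "\<And>j. j < dim \<Longrightarrow> almost_all (\<lambda>i. \<sigma> (x j) i = rep (l i) ! j)"
    by metis
  define xs where "xs = map x [0..<dim]"
  have xs: "length xs = dim" "set xs \<subseteq> internal (univ M)"
    using x(1) by (auto simp: xs_def)
  have "almost_all (\<lambda>i. map (\<lambda>j. \<sigma> (x j) i) [0..<dim] = map (\<lambda>j. rep (l i) ! j) [0..<dim])"
    using x(2) by (intro almost_all_map_cong) auto
  then have \<sigma>_xs: "almost_all (\<lambda>i. at_index i (map \<sigma> xs) = rep (l i))"
  proof eventually_elim
    case (elim i)
    have "at_index i (map \<sigma> xs) = map (\<lambda>j. \<sigma> (x j) i) [0..<dim]"
      by (simp add: xs_def comp_def)
    also have "\<dots> = rep (l i)"
      unfolding elim using D_subset[OF rep(1)[of "l i"]] by (auto intro!: nth_equalityI)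
    finally show ?case .
  qed
  then have "almost_all (\<lambda>i. at_index i (map \<sigma> xs) \<in> D)"
    by eventually_elim (simp only: rep)
  then have "almost_all (\<lambda>i. at_index i xs \<in> D)"
    using \<sigma>_D_iff[OF xs] by blast
  then have "almost_all (\<lambda>i. f (at_index i (map \<sigma> xs)) = \<tau> (\<lambda>i. f (at_index i xs)) i)"
    by (intro \<tau>_eqI xs) simp_all
  with \<sigma>_xs have "almost_all (\<lambda>i. \<tau> (\<lambda>i. f (at_index i xs)) i = l i)"
    by eventually_elim (simp only: rep)
  then show ?thesis by blast
qed

section \<open>Transfer of arithmetical statements along \<tau>\<close>

definition transfers_to :: "('i \<Rightarrow> int) \<Rightarrow> ('i \<Rightarrow> int) \<Rightarrow> bool" where
  "transfers_to k k' \<longleftrightarrow> almost_all (\<lambda>i. \<tau> k i = k' i)"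

lemma transfers_to_\<tau>: "transfers_to k (\<tau> k)"
  by (simp add: transfers_to_def)

lemma transfers_to_const: "transfers_to (\<lambda>_. c) (\<lambda>_. c)"
  using \<tau>_const by (simp add: transfers_to_def)

lemma transfers_to_add:
  assumes "transfers_to k k'" "transfers_to l l'"
  shows "transfers_to (\<lambda>i. k i + l i) (\<lambda>i. k' i + l' i)"
  using \<tau>_add[of k l] assms unfolding transfers_to_def by eventually_elim simp

lemma transfers_to_mult:
  assumes "transfers_to k k'" "transfers_to l l'"
  shows "transfers_to (\<lambda>i. k i * l i) (\<lambda>i. k' i * l' i)"
  using \<tau>_mult[of k l] assms unfolding transfers_to_def by eventually_elim simp

lemma transfers_to_uminus: "transfers_to k k' \<Longrightarrow> transfers_to (\<lambda>i. - k i) (\<lambda>i. - k' i)"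
  using transfers_to_mult[OF transfers_to_const[of "- 1"], of k k'] by simp

lemma transfers_to_diff:
  "transfers_to k k' \<Longrightarrow> transfers_to l l' \<Longrightarrow> transfers_to (\<lambda>i. k i - l i) (\<lambda>i. k' i - l' i)"
  using transfers_to_add[OF _ transfers_to_uminus, of k k' l l'] by simp

lemma same_truth_eq:
  assumes "transfers_to k k'" "transfers_to l l'"
  shows "same_truth (\<lambda>i. k i = l i) (\<lambda>i. k' i = l' i)"
proof -
  have *: "same_truth (\<lambda>i. k i = l i) (\<lambda>i. \<tau> k i = \<tau> l i)"
    by (simp add: same_truth_def \<tau>_eq_iff)
  have "almost_all (\<lambda>i. (\<tau> k i = \<tau> l i) = (k' i = l' i))"
    using assms unfolding transfers_to_def by eventually_elim simp
  then show ?thesis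
    by (rule same_truth_cong[OF *, rotated]) simp
qed

text \<open>Chosen witnesses are moved forward by \<tau> and backward by its surjectivity, so P and
  P' need to be compared only on pairs z, \<tau> z.\<close>

lemma same_truth_ex:
  assumes "\<And>z. same_truth (\<lambda>i. P i (z i)) (\<lambda>i. P' i (\<tau> z i))"
  shows "same_truth (\<lambda>i. \<exists>z. P i z) (\<lambda>i. \<exists>z. P' i z)"
  unfolding same_truth_def
proof
  assume "almost_all (\<lambda>i. \<exists>z. P i z)"
  then have "almost_all (\<lambda>i. P i (SOME z. P i z))"
    by eventually_elim (rule someI_ex)
  then have "almost_all (\<lambda>i. P' i (\<tau> (\<lambda>i. SOME z. P i z) i))"
    using assms[of "\<lambda>i. SOME z. P i z"] by (simp add: same_truth_def)
  then show "almost_all (\<lambda>i. \<exists>z. P' i z)"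
    by eventually_elim blast
next
  assume "almost_all (\<lambda>i. \<exists>z. P' i z)"
  then have *: "almost_all (\<lambda>i. P' i (SOME z. P' i z))"
    by eventually_elim (rule someI_ex)
  obtain k where "almost_all (\<lambda>i. \<tau> k i = (SOME z. P' i z))"
    using \<tau>_surj[of "\<lambda>i. SOME z. P' i z"] by blast
  with * have "almost_all (\<lambda>i. P' i (\<tau> k i))"
    by eventually_elim simp
  then have "almost_all (\<lambda>i. P i (k i))"
    using assms[of k] by (simp add: same_truth_def)
  then show "almost_all (\<lambda>i. \<exists>z. P i z)"
    by eventually_elim blast
qed

lemma same_truth_all:
  assumes "\<And>z. same_truth (\<lambda>i. P i (z i)) (\<lambda>i. P' i (\<tau> z i))"
  shows "same_truth (\<lambda>i. \<forall>z. P i z) (\<lambda>i. \<forall>z. P' i z)"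
proof -
  have "same_truth (\<lambda>i. \<not> (\<exists>z. \<not> P i z)) (\<lambda>i. \<not> (\<exists>z. \<not> P' i z))"
    by (intro same_truth_not same_truth_ex assms)
  then show ?thesis by (simp only: not_ex not_not)
qed

lemma same_truth_ex_list:
  assumes "\<And>zs. length zs = m \<Longrightarrow> same_truth (\<lambda>i. P i (at_index i zs)) (\<lambda>i. P' i (at_index i (map \<tau> zs)))"
  shows "same_truth (\<lambda>i. \<exists>u. length u = m \<and> P i u) (\<lambda>i. \<exists>u. length u = m \<and> P' i u)"
  unfolding same_truth_def
proof
  assume "almost_all (\<lambda>i. \<exists>u. length u = m \<and> P i u)"
  then have *: "almost_all (\<lambda>i. length (SOME u. length u = m \<and> P i u) = m \<and> P i (SOME u. length u = m \<and> P i u))"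
    by eventually_elim (rule someI_ex)
  define zs where "zs = map (\<lambda>j i. (SOME u. length u = m \<and> P i u) ! j) [0..<m]"
  have "almost_all (\<lambda>i. P i (at_index i zs))"
    using *
  proof eventually_elim
    case (elim i)
    then have "at_index i zs = (SOME u. length u = m \<and> P i u)"
      by (auto simp: zs_def comp_def intro!: nth_equalityI)
    then show ?case using elim by simp
  qed
  moreover have len: "length zs = m" by (simp add: zs_def)
  ultimately have "almost_all (\<lambda>i. P' i (at_index i (map \<tau> zs)))"
    using assms[of zs] by (simp only: same_truth_def)
  then show "almost_all (\<lambda>i. \<exists>u. length u = m \<and> P' i u)"
  proof eventually_elim
    case (elim i)
    then show ?case using len by (intro exI[of _ "at_index i (map \<tau> zs)"]) simp
  qed
next
  assume "almost_all (\<lambda>i. \<exists>u. length u = m \<and> P' i u)"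
  then have *: "almost_all (\<lambda>i. length (SOME u. length u = m \<and> P' i u) = m \<and> P' i (SOME u. length u = m \<and> P' i u))"
    by eventually_elim (rule someI_ex)
  have "\<forall>j. \<exists>k. almost_all (\<lambda>i. \<tau> k i = (SOME u. length u = m \<and> P' i u) ! j)"
    by (intro allI \<tau>_surj)
  then obtain k where k: "\<And>j. almost_all (\<lambda>i. \<tau> (k j) i = (SOME u. length u = m \<and> P' i u) ! j)"
    by metis
  define zs where "zs = map k [0..<m]"
  have len: "length zs = m" by (simp add: zs_def)
  have "almost_all (\<lambda>i. map (\<lambda>j. \<tau> (k j) i) [0..<m] = map (\<lambda>j. (SOME u. length u = m \<and> P' i u) ! j) [0..<m])"
    by (intro almost_all_map_cong k)
  with * have "almost_all (\<lambda>i. P' i (at_index i (map \<tau> zs)))"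
  proof eventually_elim
    case (elim i)
    have "at_index i (map \<tau> zs) = map (\<lambda>j. \<tau> (k j) i) [0..<m]"
      by (simp add: zs_def comp_def)
    also have "\<dots> = (SOME u. length u = m \<and> P' i u)"
      unfolding elim(2) using elim(1) by (intro nth_equalityI) auto
    finally show ?case using elim(1) by simp
  qed
  then have "almost_all (\<lambda>i. P i (at_index i zs))"
    using assms[OF len] by (simp only: same_truth_def)
  then show "almost_all (\<lambda>i. \<exists>u. length u = m \<and> P i u)"
  proof eventually_elim
    case (elim i)
    then show ?case using len by (intro exI[of _ "at_index i zs"]) simp
  qed
qed

text \<open>The order is preserved because nonnegativity has been expressed by ring equations, which
  \<tau> respects.\<close>

lemma same_truth_nonneg:
  assumes "transfers_to k k'"
  shows "same_truth (\<lambda>i. 0 \<le> k i) (\<lambda>i. 0 \<le> k' i)"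
  unfolding nonneg_iff_square_multiple
  by (intro same_truth_ex same_truth_conj same_truth_not same_truth_eq transfers_to_add transfers_to_mult
      transfers_to_const transfers_to_\<tau> assms)

lemma same_truth_le:
  assumes "transfers_to k k'" "transfers_to l l'"
  shows "same_truth (\<lambda>i. k i \<le> l i) (\<lambda>i. k' i \<le> l' i)"
  using same_truth_nonneg[OF transfers_to_diff[OF assms(2,1)]] by simp

lemma same_truth_dvd:
  assumes "transfers_to k k'" "transfers_to l l'"
  shows "same_truth (\<lambda>i. k i dvd l i) (\<lambda>i. k' i dvd l' i)"
  unfolding dvd_def
  by (intro same_truth_ex same_truth_eq transfers_to_mult transfers_to_\<tau> assms)

section \<open>Transfer of statements about ring elements and their codes\<close>

lemma same_truth_bex:
  assumes "univ M \<noteq> {}"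
    and "\<And>x. x \<in> internal (univ M) \<Longrightarrow> same_truth (\<lambda>i. P i (x i)) (\<lambda>i. P' i (\<sigma> x i))"
  shows "same_truth (\<lambda>i. \<exists>x\<in>univ M. P i x) (\<lambda>i. \<exists>x\<in>univ M. P' i x)"
  unfolding same_truth_def almost_all_bex[OF assms(1)]
proof
  assume "\<exists>x\<in>internal (univ M). almost_all (\<lambda>i. P i (x i))"
  then obtain x where x: "x \<in> internal (univ M)" "almost_all (\<lambda>i. P i (x i))" by blast
  then have "almost_all (\<lambda>i. P' i (\<sigma> x i))"
    using assms(2)[OF x(1)] by (simp only: same_truth_def)
  then show "\<exists>x\<in>internal (univ M). almost_all (\<lambda>i. P' i (x i))"
    using \<sigma>_closed[OF x(1)] by (rule bexI)
next
  assume "\<exists>x\<in>internal (univ M). almost_all (\<lambda>i. P' i (x i))"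
  then obtain y where y: "y \<in> internal (univ M)" "almost_all (\<lambda>i. P' i (y i))" by blast
  obtain x where x: "x \<in> internal (univ M)" "almost_all (\<lambda>i. \<sigma> x i = y i)"
    using \<sigma>_surj[OF y(1)] by blast
  have "almost_all (\<lambda>i. P' i (\<sigma> x i))"
    using y(2) x(2) by eventually_elim simp
  then have "almost_all (\<lambda>i. P i (x i))"
    using assms(2)[OF x(1)] by (simp only: same_truth_def)
  then show "\<exists>x\<in>internal (univ M). almost_all (\<lambda>i. P i (x i))"
    using x(1) by (rule bexI)
qed

lemma same_truth_ball:
  assumes "univ M \<noteq> {}"
    and "\<And>x. x \<in> internal (univ M) \<Longrightarrow> same_truth (\<lambda>i. P i (x i)) (\<lambda>i. P' i (\<sigma> x i))"
  shows "same_truth (\<lambda>i. \<forall>x\<in>univ M. P i x) (\<lambda>i. \<forall>x\<in>univ M. P' i x)"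
proof -
  have "same_truth (\<lambda>i. \<not> (\<exists>x\<in>univ M. \<not> P i x)) (\<lambda>i. \<not> (\<exists>x\<in>univ M. \<not> P' i x))"
    by (intro same_truth_not same_truth_bex assms)
  then show ?thesis by (simp only: bex_simps ball_simps not_not)
qed

text \<open>The link between the two automorphisms: g carries \<tau> on codes to \<sigma> on ring
  elements. It is here that definability of the isomorphism of M with its copy inside M
  enters.\<close>

lemma same_truth_graph:
  assumes graph: "definable M (1 + m * dim) (composite_graph m D f E g)"
    and u: "length u = m" and x: "x \<in> internal (univ M)"
  shows "same_truth (\<lambda>i. at_index i u \<in> E \<and> g (at_index i u) = x i)
    (\<lambda>i. at_index i (map \<tau> u) \<in> E \<and> g (at_index i (map \<tau> u)) = \<sigma> x i)"
proof -
  let ?X = "composite_graph m D f E g"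
  let ?xs = "x # concat (map reps u)"
  have X: "a # concat ass \<in> ?X \<longleftrightarrow> map f ass \<in> E \<and> g (map f ass) = a"
    if ass: "length ass = m" "set ass \<subseteq> D" for a ass
  proof
    assume "a # concat ass \<in> ?X"
    then obtain xss where *: "a = g (map f xss)" "concat ass = concat xss" "xss \<in> tuples D m" "map f xss \<in> E"
      unfolding composite_graph_def by auto
    then have "ass = xss \<and> [] = ([] :: 'a list)"
      using ass D_subset by (intro concat_inject[where n = dim]) (auto simp: tuples_def)
    then show "map f ass \<in> E \<and> g (map f ass) = a"
      using * by blast
  next
    assume "map f ass \<in> E \<and> g (map f ass) = a"
    then show "a # concat ass \<in> ?X"
      using ass unfolding composite_graph_def tuples_def by auto
  qed
  have "length ?xs = 1 + m * dim"
    by (simp add: length_concat comp_def u sum_list_triv)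
  moreover have "set ?xs \<subseteq> internal (univ M)"
    using x reps_internal by auto
  ultimately have inv: "same_truth (\<lambda>i. at_index i ?xs \<in> ?X) (\<lambda>i. at_index i (map \<sigma> ?xs) \<in> ?X)"
    unfolding same_truth_def using definable_invariant[OF graph, of ?xs] by blast
  have at: "at_index i ?xs = x i # concat (map (\<lambda>k. at_index i (reps k)) u)" for i
    by (simp only: list.map map_concat map_map comp_def)
  have at_\<sigma>: "at_index i (map \<sigma> ?xs) = \<sigma> x i # concat (map (\<lambda>k. at_index i (map \<sigma> (reps k))) u)" for i
    by (simp only: list.map map_concat map_map comp_def)
  have "at_index i ?xs \<in> ?X \<longleftrightarrow> at_index i u \<in> E \<and> g (at_index i u) = x i" for i
    unfolding at by (subst X) (auto simp: u rep comp_def)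
  moreover have "almost_all (\<lambda>i. \<forall>k\<in>set u. at_index i (map \<sigma> (reps k)) \<in> D)"
    by (intro eventually_ball_finite ballI almost_all_\<sigma>_reps_in_D) simp
  then have "almost_all (\<lambda>i. at_index i (map \<sigma> ?xs) \<in> ?X \<longleftrightarrow>
      at_index i (map \<tau> u) \<in> E \<and> g (at_index i (map \<tau> u)) = \<sigma> x i)"
  proof eventually_elim
    case (elim i)
    have at_\<tau>: "at_index i (map \<tau> u) = map f (map (\<lambda>k. at_index i (map \<sigma> (reps k))) u)"
      by (simp only: map_map comp_def \<tau>_def)
    show ?case
      unfolding at_\<sigma> at_\<tau> by (rule X) (use elim u in auto)
  qed
  ultimately show ?thesis
    using same_truth_cong[OF inv] by simp
qed

end

section \<open>Shearing an ultrapower of a ring along its annihilator\<close>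

context nonassoc_ring
begin

lemma zero_multiple [simp]: "[(0::int)] \<cdot> x = \<zero>"
  by (simp add: add_pow_def)

lemma Ann_subgroup: "subgroup (Ann R) (add_monoid R)"
proof -
  have zero: "\<zero> \<otimes> y = \<zero>" "y \<otimes> \<zero> = \<zero>" if "y \<in> carrier R" for y
    using l_distr[of \<zero> \<zero> y] r_distr[of \<zero> \<zero> y] m_closed that
    by (metis add.l_cancel_one add.m_closed add.one_closed l_zero)+
  have minus: "(\<ominus> x) \<otimes> y = \<zero> \<and> y \<otimes> (\<ominus> x) = \<zero>" if x: "x \<in> Ann R" and y: "y \<in> carrier R" for x y
  proof -
    have xc: "x \<in> carrier R" "x \<otimes> y = \<zero>" "y \<otimes> x = \<zero>"
      using x y by (auto simp: Ann_def)
    have "(\<ominus> x) \<otimes> y \<oplus> x \<otimes> y = \<zero>" "y \<otimes> (\<ominus> x) \<oplus> y \<otimes> x = \<zero>"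
      using l_distr[of "\<ominus> x" x y] r_distr[of "\<ominus> x" x y] xc y zero by (simp_all add: l_neg)
    then show ?thesis
      using xc y m_closed by simp
  qed
  show ?thesis
  proof (rule subgroup.intro)
    show "Ann R \<subseteq> carrier (add_monoid R)" by (auto simp: Ann_def)
    show "x \<otimes>\<^bsub>add_monoid R\<^esub> y \<in> Ann R" if "x \<in> Ann R" "y \<in> Ann R" for x y
      using that by (auto simp: Ann_def l_distr r_distr)
    show "\<one>\<^bsub>add_monoid R\<^esub> \<in> Ann R" using zero by (auto simp: Ann_def)
    show "inv\<^bsub>add_monoid R\<^esub> x \<in> Ann R" if "x \<in> Ann R" for x
      using that minus[OF that] by (auto simp: Ann_def a_inv_def[symmetric])
  qed
qed

lemma Ann_multiple: "a \<in> Ann R \<Longrightarrow> [(k::int)] \<cdot> a \<in> Ann R"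
  using add.subgroup_int_pow_closed[OF Ann_subgroup] .

lemma mult_Ann_cosets:
  assumes "x \<in> carrier R" "y \<in> carrier R" "b \<in> Ann R" "c \<in> Ann R"
  shows "(x \<oplus> b) \<otimes> (y \<oplus> c) = x \<otimes> y"
  using assms m_closed by (auto simp: Ann_def l_distr r_distr)

lemma multiple_eq_iff:
  assumes "a \<in> carrier R" "\<And>n::nat. 0 < n \<Longrightarrow> [n] \<cdot> a \<noteq> \<zero>"
  shows "[(k::int)] \<cdot> a = [l] \<cdot> a \<longleftrightarrow> k = l"
proof
  assume eq: "[k] \<cdot> a = [l] \<cdot> a"
  have diff: "[(p - q)] \<cdot> a = \<zero>" if "[(p::int)] \<cdot> a = [q] \<cdot> a" for p q
    using that assms(1) by (simp add: add.int_pow_diff r_neg)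
  have "k - l \<le> 0 \<and> l - k \<le> 0"
  proof (rule ccontr)
    assume "\<not> ?thesis"
    then have "0 < k - l \<or> 0 < l - k" by linarith
    then obtain n :: nat where "0 < n" "int n = k - l \<or> int n = l - k"
      by (metis pos_int_cases)
    then have "[n] \<cdot> a = \<zero>"
      using diff[OF eq] diff[OF eq[symmetric]] add_pow_int_ge[of "int n" R a] by auto
    then show False using assms(2) \<open>0 < n\<close> by blast
  qed
  then show "k = l" by linarith
qed simp

end

text \<open>Adding \<open>\<theta> \<circ> \<rho>\<close> times \<open>a\<close> is an automorphism of the ultrapower: it is additive, products do not
  see the annihilator and are killed by \<open>\<rho>\<close>, and \<open>\<theta>\<^sup>2 = 0\<close> gives the inverse.\<close>

locale shear = nonassoc_ring R + ultrafilter U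
  for R (structure) and U :: "'i filter" +
  fixes \<rho> :: "'a \<Rightarrow> int" and a :: 'a and \<theta> :: "('i \<Rightarrow> int) \<Rightarrow> 'i \<Rightarrow> int"
  assumes \<rho>_add: "x \<in> carrier R \<Longrightarrow> y \<in> carrier R \<Longrightarrow> \<rho> (x \<oplus> y) = \<rho> x + \<rho> y"
    and \<rho>_mult: "x \<in> carrier R \<Longrightarrow> y \<in> carrier R \<Longrightarrow> \<rho> (x \<otimes> y) = 0"
    and a_Ann: "a \<in> Ann R"
    and \<theta>_cong: "almost_all (\<lambda>i. k i = l i) \<Longrightarrow> almost_all (\<lambda>i. \<theta> k i = \<theta> l i)"
    and \<theta>_add: "almost_all (\<lambda>i. \<theta> (\<lambda>i. k i + l i) i = \<theta> k i + \<theta> l i)"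
    and \<theta>_const: "almost_all (\<lambda>i. \<theta> (\<lambda>_. c) i = 0)"
    and \<theta>_\<theta>: "almost_all (\<lambda>i. \<theta> (\<lambda>i. \<theta> k i * c) i = 0)"
begin

definition \<sigma> :: "('i \<Rightarrow> 'a) \<Rightarrow> 'i \<Rightarrow> 'a" where
  "\<sigma> x i = x i \<oplus> [\<theta> (\<lambda>i. \<rho> (x i)) i] \<cdot> a"

lemma a_closed [simp]: "a \<in> carrier R"
  using a_Ann by (simp add: Ann_def)

lemma \<rho>_zero: "\<rho> \<zero> = 0"
  using \<rho>_add[of \<zero> \<zero>] by simp

lemma \<rho>_minus: "x \<in> carrier R \<Longrightarrow> \<rho> (\<ominus> x) = - \<rho> x"
  using \<rho>_add[of "\<ominus> x" x] by (simp add: \<rho>_zero l_neg)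

lemma \<rho>_multiple:
  assumes "x \<in> carrier R"
  shows "\<rho> ([(k::int)] \<cdot> x) = k * \<rho> x"
proof -
  have nat: "\<rho> ([n] \<cdot> x) = int n * \<rho> x" for n :: nat
    using assms by (induction n) (simp_all add: \<rho>_zero \<rho>_add algebra_simps)
  show ?thesis
  proof (cases "k \<ge> 0")
    case True
    then show ?thesis using nat[of "nat k"] by (simp add: add_pow_int_ge)
  next
    case False
    then show ?thesis using nat[of "nat (- k)"] assms by (simp add: add_pow_int_lt \<rho>_minus)
  qed
qed

text \<open>Shearing changes \<rho> x only by a multiple of a value of \<theta>, which \<theta> does
  not see. So x and its image have the same correction term, and subtracting it inverts
  \<sigma>.\<close>

lemma \<theta>_\<rho>_shift:
  "almost_all (\<lambda>i. \<theta> (\<lambda>i. p i + \<theta> q i * c) i = \<theta> p i)"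
  using \<theta>_add[of p "\<lambda>i. \<theta> q i * c"] \<theta>_\<theta>[of q c] by eventually_elim simp

lemma \<sigma>_internal: "x \<in> internal (carrier R) \<Longrightarrow> \<sigma> x \<in> internal (carrier R)"
  by (intro internalI) (simp add: \<sigma>_def internalD)

lemma \<sigma>_respects:
  assumes "almost_all (\<lambda>i. x i = y i)"
  shows "almost_all (\<lambda>i. \<sigma> x i = \<sigma> y i)"
proof -
  have "almost_all (\<lambda>i. \<rho> (x i) = \<rho> (y i))"
    using assms by eventually_elim simp
  from \<theta>_cong[OF this] assms show ?thesis
    by eventually_elim (simp add: \<sigma>_def)
qed

lemma \<rho>_\<sigma>: "x \<in> internal (carrier R) \<Longrightarrow> \<rho> (\<sigma> x i) = \<rho> (x i) + \<theta> (\<lambda>i. \<rho> (x i)) i * \<rho> a"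
  by (simp add: \<sigma>_def \<rho>_add \<rho>_multiple internalD)

lemma \<sigma>_injective:
  assumes x: "x \<in> internal (carrier R)" and y: "y \<in> internal (carrier R)"
    and eq: "almost_all (\<lambda>i. \<sigma> x i = \<sigma> y i)"
  shows "almost_all (\<lambda>i. x i = y i)"
proof -
  let ?p = "\<lambda>i. \<rho> (x i)" and ?q = "\<lambda>i. \<rho> (y i)"
  have "almost_all (\<lambda>i. ?p i + \<theta> ?p i * \<rho> a = ?q i + \<theta> ?q i * \<rho> a)"
    using eq by eventually_elim (simp add: \<rho>_\<sigma>[OF x, symmetric] \<rho>_\<sigma>[OF y, symmetric])
  from \<theta>_cong[OF this] have "almost_all (\<lambda>i. \<theta> ?p i = \<theta> ?q i)"
    using \<theta>_\<rho>_shift[of ?p ?p "\<rho> a"] \<theta>_\<rho>_shift[of ?q ?q "\<rho> a"] by eventually_elim simp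
  with eq show ?thesis
  proof eventually_elim
    case (elim i)
    then have "x i \<oplus> [\<theta> ?q i] \<cdot> a = y i \<oplus> [\<theta> ?q i] \<cdot> a"
      by (simp add: \<sigma>_def)
    then show ?case
      using internalD[OF x] internalD[OF y] by simp
  qed
qed

lemma \<sigma>_surjective:
  assumes y: "y \<in> internal (carrier R)"
  shows "\<exists>x\<in>internal (carrier R). almost_all (\<lambda>i. \<sigma> x i = y i)"
proof -
  let ?q = "\<lambda>i. \<rho> (y i)"
  define x where "x i = y i \<oplus> [(- \<theta> ?q i)] \<cdot> a" for i
  have x: "x \<in> internal (carrier R)"
    using internalD[OF y] by (intro internalI) (simp add: x_def)
  have \<rho>_x: "(\<lambda>i. \<rho> (x i)) = (\<lambda>i. ?q i + \<theta> ?q i * (- \<rho> a))"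
    using internalD[OF y] by (simp add: x_def \<rho>_add \<rho>_multiple)
  have "almost_all (\<lambda>i. \<sigma> x i = y i)"
    using \<theta>_\<rho>_shift[of ?q ?q "- \<rho> a"]
  proof eventually_elim
    case (elim i)
    have "\<sigma> x i = (y i \<oplus> [(- \<theta> ?q i)] \<cdot> a) \<oplus> [\<theta> ?q i] \<cdot> a"
      unfolding \<sigma>_def \<rho>_x elim by (simp only: x_def)
    also have "\<dots> = y i \<oplus> ([(- \<theta> ?q i)] \<cdot> a \<oplus> [\<theta> ?q i] \<cdot> a)"
      using internalD[OF y] by (simp add: a_assoc)
    also have "[(- \<theta> ?q i)] \<cdot> a \<oplus> [\<theta> ?q i] \<cdot> a = \<zero>"
      by (simp add: add.int_pow_mult[symmetric])
    finally show ?case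
      using internalD[OF y] by simp
  qed
  then show ?thesis using x by blast
qed

lemma \<sigma>_add:
  assumes x: "x \<in> internal (carrier R)" and y: "y \<in> internal (carrier R)"
  shows "almost_all (\<lambda>i. \<sigma> (\<lambda>i. x i \<oplus> y i) i = \<sigma> x i \<oplus> \<sigma> y i)"
proof -
  have \<rho>: "(\<lambda>i. \<rho> (x i \<oplus> y i)) = (\<lambda>i. \<rho> (x i) + \<rho> (y i))"
    using internalD[OF x] internalD[OF y] by (simp add: \<rho>_add)
  show ?thesis
    using \<theta>_add[of "\<lambda>i. \<rho> (x i)" "\<lambda>i. \<rho> (y i)"]
  proof eventually_elim
    case (elim i)
    show ?case
      unfolding \<sigma>_def \<rho> elim using internalD[OF x, of i] internalD[OF y, of i]
      by (simp add: add.int_pow_mult a_ac)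
  qed
qed

lemma \<sigma>_mult:
  assumes x: "x \<in> internal (carrier R)" and y: "y \<in> internal (carrier R)"
  shows "almost_all (\<lambda>i. \<sigma> (\<lambda>i. x i \<otimes> y i) i = \<sigma> x i \<otimes> \<sigma> y i)"
proof -
  \<comment> \<open>The product gets no correction since \<rho> kills it, and the corrections of the
    factors lie in the annihilator.\<close>
  have \<rho>: "(\<lambda>i. \<rho> (x i \<otimes> y i)) = (\<lambda>i. 0)"
    using internalD[OF x] internalD[OF y] by (simp add: \<rho>_mult)
  show ?thesis
    using \<theta>_const[of 0]
  proof eventually_elim
    case (elim i)
    show ?case
      unfolding \<sigma>_def \<rho> elim using internalD[OF x, of i] internalD[OF y, of i]
      by (simp add: mult_Ann_cosets Ann_multiple a_Ann m_closed)
  qed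
qed

lemma ultrapower_automorphism: "ultrapower_automorphism U (ring_structure R) \<sigma>"
proof unfold_locales
  fix h as
  assume "fun_ar (ring_structure R) h = Some (length as)" "set as \<subseteq> univ (ring_structure R)"
  then show "fun_of (ring_structure R) h as \<in> univ (ring_structure R)"
    by (cases h) (auto simp: ring_structure_def m_closed subset_iff)
next
  fix x :: "'i \<Rightarrow> 'a" assume "x \<in> internal (univ (ring_structure R))"
  then show "\<sigma> x \<in> internal (univ (ring_structure R))"
    by (simp add: ring_structure_def \<sigma>_internal)
next
  fix x y :: "'i \<Rightarrow> 'a"
  assume "x \<in> internal (univ (ring_structure R))" "y \<in> internal (univ (ring_structure R))"
  then show "almost_all (\<lambda>i. \<sigma> x i = \<sigma> y i) \<longleftrightarrow> almost_all (\<lambda>i. x i = y i)"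
    using \<sigma>_injective \<sigma>_respects by (auto simp: ring_structure_def)
next
  fix y :: "'i \<Rightarrow> 'a" assume "y \<in> internal (univ (ring_structure R))"
  then show "\<exists>x\<in>internal (univ (ring_structure R)). almost_all (\<lambda>i. \<sigma> x i = y i)"
    using \<sigma>_surjective by (simp add: ring_structure_def)
next
  fix c assume "c \<in> univ (ring_structure R)"
  then have "c \<in> carrier R" by (simp add: ring_structure_def)
  with \<theta>_const[of "\<rho> c"] show "almost_all (\<lambda>i. \<sigma> (\<lambda>_. c) i = c)"
    by (auto simp: \<sigma>_def elim: eventually_mono)
next
  fix h and xs :: "('i \<Rightarrow> 'a) list"
  assume xs: "fun_ar (ring_structure R) h = Some (length xs)" "set xs \<subseteq> internal (univ (ring_structure R))"
  then have "length xs = Suc (Suc 0)"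
    by (simp add: ring_structure_def)
  then obtain x y where "xs = [x, y]"
    by (auto simp: length_Suc_conv)
  moreover from this have "x \<in> internal (carrier R)" "y \<in> internal (carrier R)"
    using xs by (auto simp: ring_structure_def)
  ultimately show "almost_all (\<lambda>i. \<sigma> (\<lambda>j. fun_of (ring_structure R) h (at_index j xs)) i =
      fun_of (ring_structure R) h (at_index i (map \<sigma> xs)))"
    using \<sigma>_add[of x y] \<sigma>_mult[of x y] by (cases h) (simp_all add: ring_structure_def)
next
  fix r and xs :: "('i \<Rightarrow> 'a) list"
  assume "rel_ar (ring_structure R) r = Some (length xs)"
  then show "almost_all (\<lambda>i. rel_of (ring_structure R) r (at_index i (map \<sigma> xs))) \<longleftrightarrow>
      almost_all (\<lambda>i. rel_of (ring_structure R) r (at_index i xs))"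
    by (simp add: ring_structure_def)
qed

end

section \<open>Definability of the multiples of an element\<close>

locale ring_with_integers = nonassoc_ring R + interpreted_integers U "ring_structure R" \<sigma> dim D f
  for R (structure) and U :: "'i filter" and \<sigma> dim D f +
  fixes m :: nat and E :: "int list set" and g :: "int list \<Rightarrow> 'a"
  assumes E: "E \<subseteq> tuples UNIV m" and g_onto: "g ` E = carrier R"
    and graph: "definable (ring_structure R) (1 + m * dim) (composite_graph m D f E g)"
begin

lemma univ_carrier [simp]: "univ (ring_structure R) = carrier R"
  by (simp add: ring_structure_def)

lemma \<sigma>_plus:
  assumes "x \<in> internal (carrier R)" "y \<in> internal (carrier R)"
  shows "almost_all (\<lambda>i. \<sigma> (\<lambda>i. x i \<oplus> y i) i = \<sigma> x i \<oplus> \<sigma> y i)"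
  using \<sigma>_fun_of[of Add "[x, y]"] assms by (simp add: ring_structure_def)

lemma same_truth_eq_const:
  assumes "x \<in> internal (carrier R)" "c \<in> carrier R"
  shows "same_truth (\<lambda>i. x i = c) (\<lambda>i. \<sigma> x i = c)"
proof -
  have *: "same_truth (\<lambda>i. x i = c) (\<lambda>i. \<sigma> x i = \<sigma> (\<lambda>_. c) i)"
    unfolding same_truth_def using assms by (subst \<sigma>_eq_iff) (auto intro: internalI)
  have "almost_all (\<lambda>i. (\<sigma> x i = \<sigma> (\<lambda>_. c) i) = (\<sigma> x i = c))"
    using \<sigma>_const[of c] assms by (auto elim: eventually_mono)
  then show ?thesis
    by (rule same_truth_cong[OF *, rotated]) simp
qed

lemma same_truth_eq_plus:
  assumes x: "x \<in> internal (carrier R)" and y: "y \<in> internal (carrier R)" and c: "c \<in> carrier R"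
  shows "same_truth (\<lambda>i. x i = y i \<oplus> c) (\<lambda>i. \<sigma> x i = \<sigma> y i \<oplus> c)"
proof -
  let ?z = "\<lambda>i. y i \<oplus> c"
  have z: "?z \<in> internal (carrier R)"
    using internalD[OF y] c by (intro internalI) simp
  have *: "same_truth (\<lambda>i. x i = ?z i) (\<lambda>i. \<sigma> x i = \<sigma> ?z i)"
    unfolding same_truth_def using x z by (subst \<sigma>_eq_iff) auto
  have "almost_all (\<lambda>i. \<sigma> ?z i = \<sigma> y i \<oplus> \<sigma> (\<lambda>_. c) i)"
    using y c by (intro \<sigma>_plus) (auto intro: internalI)
  moreover have "almost_all (\<lambda>i. \<sigma> (\<lambda>_. c) i = c)"
    using c by (intro \<sigma>_const) simp
  ultimately have "almost_all (\<lambda>i. (\<sigma> x i = \<sigma> ?z i) = (\<sigma> x i = \<sigma> y i \<oplus> c))"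
    by eventually_elim simp
  then show ?thesis
    by (rule same_truth_cong[OF *, rotated]) simp
qed

text \<open>\<open>coded s t B k i v\<close>: the list \<open>s\<close>, read coordinatewise with the beta function, relates the index
  \<open>i \<le> k\<close> to a tuple that \<open>g\<close> sends to \<open>v\<close>.\<close>

definition coded :: "int list \<Rightarrow> int \<Rightarrow> int \<Rightarrow> int \<Rightarrow> int \<Rightarrow> 'a \<Rightarrow> bool" where
  "coded s t B k i v \<longleftrightarrow> 0 \<le> i \<and> i \<le> k \<and>
    (\<exists>u. length u = m \<and> (u \<in> E \<and> g u = v) \<and>
      (\<forall>j<m. 1 + (i + 1) * t dvd s ! j - u ! j \<and> - B \<le> u ! j \<and> u ! j \<le> B))"

text \<open>The recursion is stated downwards: every coded value is the start or comes from a coded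
  value one index lower. A descent must end at 0, because \<open>coded\<close> excludes negative
  indices.\<close>

definition codes_multiples :: "'a \<Rightarrow> int list \<Rightarrow> int \<Rightarrow> int \<Rightarrow> int \<Rightarrow> bool" where
  "codes_multiples a s t B k \<longleftrightarrow> (\<forall>i. \<forall>v\<in>carrier R. coded s t B k i v \<longrightarrow>
    i = 0 \<and> v = \<zero> \<or> (\<exists>w\<in>carrier R. v = w \<oplus> a \<and> coded s t B k (i - 1) w))"

lemma transfers_to_nth:
  assumes "j < length s"
  shows "transfers_to (\<lambda>i. at_index i s ! j) (\<lambda>i. at_index i (map \<tau> s) ! j)"
  using transfers_to_\<tau>[of "s ! j"] assms by simp

lemma same_truth_coded:
  assumes "transfers_to i i'" "x \<in> internal (carrier R)" and s: "length s = m"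
  shows "same_truth (\<lambda>n. coded (at_index n s) (t n) (B n) (k n) (i n) (x n))
    (\<lambda>n. coded (at_index n (map \<tau> s)) (\<tau> t n) (\<tau> B n) (\<tau> k n) (i' n) (\<sigma> x n))"
proof -
  have "same_truth
      (\<lambda>n. \<exists>u. length u = m \<and> (u \<in> E \<and> g u = x n) \<and>
         (\<forall>j<m. 1 + (i n + 1) * t n dvd at_index n s ! j - u ! j \<and> - B n \<le> u ! j \<and> u ! j \<le> B n))
      (\<lambda>n. \<exists>u. length u = m \<and> (u \<in> E \<and> g u = \<sigma> x n) \<and>
         (\<forall>j<m. 1 + (i' n + 1) * \<tau> t n dvd at_index n (map \<tau> s) ! j - u ! j \<and>
           - \<tau> B n \<le> u ! j \<and> u ! j \<le> \<tau> B n))"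
  proof (rule same_truth_ex_list)
    fix zs :: "('i \<Rightarrow> int) list" assume zs: "length zs = m"
    have graph_zs: "same_truth (\<lambda>i. at_index i zs \<in> E \<and> g (at_index i zs) = x i)
        (\<lambda>i. at_index i (map \<tau> zs) \<in> E \<and> g (at_index i (map \<tau> zs)) = \<sigma> x i)"
      using graph zs by (rule same_truth_graph) (simp add: assms)
    have all_zs: "same_truth
        (\<lambda>n. \<forall>j<m. 1 + (i n + 1) * t n dvd at_index n s ! j - at_index n zs ! j \<and>
           - B n \<le> at_index n zs ! j \<and> at_index n zs ! j \<le> B n)
        (\<lambda>n. \<forall>j<m. 1 + (i' n + 1) * \<tau> t n dvd at_index n (map \<tau> s) ! j - at_index n (map \<tau> zs) ! j \<and>
           - \<tau> B n \<le> at_index n (map \<tau> zs) ! j \<and> at_index n (map \<tau> zs) ! j \<le> \<tau> B n)"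
      by (intro same_truth_all_less same_truth_conj same_truth_dvd same_truth_le transfers_to_add
          transfers_to_mult transfers_to_diff transfers_to_uminus transfers_to_const transfers_to_\<tau>
          transfers_to_nth assms) (simp_all add: s zs)
    show "same_truth
        (\<lambda>n. (at_index n zs \<in> E \<and> g (at_index n zs) = x n) \<and>
           (\<forall>j<m. 1 + (i n + 1) * t n dvd at_index n s ! j - at_index n zs ! j \<and>
           - B n \<le> at_index n zs ! j \<and> at_index n zs ! j \<le> B n))
        (\<lambda>n. (at_index n (map \<tau> zs) \<in> E \<and> g (at_index n (map \<tau> zs)) = \<sigma> x n) \<and>
           (\<forall>j<m. 1 + (i' n + 1) * \<tau> t n dvd at_index n (map \<tau> s) ! j - at_index n (map \<tau> zs) ! j \<and>
           - \<tau> B n \<le> at_index n (map \<tau> zs) ! j \<and> at_index n (map \<tau> zs) ! j \<le> \<tau> B n))"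
      using graph_zs all_zs by (rule same_truth_conj)
  qed
  then show ?thesis
    unfolding coded_def by (intro same_truth_conj same_truth_le transfers_to_const transfers_to_\<tau> assms(1))
qed

lemma same_truth_codes_multiples:
  assumes "length s = m" "a \<in> carrier R"
  shows "same_truth (\<lambda>n. codes_multiples a (at_index n s) (t n) (B n) (k n))
    (\<lambda>n. codes_multiples a (at_index n (map \<tau> s)) (\<tau> t n) (\<tau> B n) (\<tau> k n))"
  unfolding codes_multiples_def univ_carrier[symmetric]
  by (intro same_truth_all same_truth_ball same_truth_bex same_truth_imp same_truth_disj same_truth_conj
      same_truth_eq same_truth_eq_const same_truth_eq_plus same_truth_coded
      transfers_to_diff transfers_to_const transfers_to_\<tau> assms)
    (use zero_closed assms in \<open>auto simp del: zero_closed\<close>)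

text \<open>Ordinary induction suffices even for nonstandard indices, since the lemma is applied at
  each index of the ultrapower separately, where the value of \<tau> is an ordinary integer.\<close>

lemma codes_multiples_sound:
  assumes a: "a \<in> carrier R" and codes: "codes_multiples a s t B k"
  shows "v \<in> carrier R \<Longrightarrow> coded s t B k (int i) v \<Longrightarrow> v = [int i] \<cdot> a"
proof (induction i arbitrary: v)
  case 0
  have "\<not> coded s t B k (- 1) w" for w
    by (simp add: coded_def)
  then have "v = \<zero>"
    using codes 0 unfolding codes_multiples_def by fastforce
  then show ?case using a by simp
next
  case (Suc i)
  then obtain w where w: "w \<in> carrier R" "v = w \<oplus> a" "coded s t B k (int (Suc i) - 1) w"
    using codes unfolding codes_multiples_def by (metis of_nat_eq_0_iff nat.distinct(1))
  then have "w = [int i] \<cdot> a"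
    using Suc.IH by simp
  then show ?case
    using w(2) a by (simp add: add.int_pow_mult add.m_comm)
qed

text \<open>Codes of 0, a, ..., k a under g are chosen, and the beta function stores them coordinate
  by coordinate with a common \<open>t\<close> and \<open>B\<close>.\<close>

lemma codes_multiples_exist:
  assumes a: "a \<in> carrier R" and k: "0 \<le> k"
  shows "\<exists>s t B. length s = m \<and> codes_multiples a s t B k \<and> coded s t B k k ([k] \<cdot> a)"
proof -
  have "\<forall>i. \<exists>u. u \<in> E \<and> g u = [int i] \<cdot> a"
    using g_onto a by (metis add.int_pow_closed imageE)
  then obtain u where u: "\<And>i. u i \<in> E" "\<And>i. g (u i) = [int i] \<cdot> a"
    by metis
  have len: "length w = m" if "w \<in> E" for w
    using E that by (auto simp: tuples_def)
  obtain t B s' where beta: "\<And>i j w. i \<le> nat k \<Longrightarrow> j < m \<Longrightarrow>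
      w = u i ! j \<longleftrightarrow> (1 + (int i + 1) * t) dvd s' j - w \<and> - B \<le> w \<and> w \<le> B"
    using beta_function[of "nat k" m "\<lambda>i j. u i ! j"] by metis
  define s where "s = map s' [0..<m]"
  \<comment> \<open>Decoding recovers the chosen tuple \<open>u i\<close> exactly, so no other ring
    element is coded at i.\<close>
  have coded_iff: "coded s t B k (int i) v \<longleftrightarrow> v = [int i] \<cdot> a" if i: "i \<le> nat k" for i v
  proof
    assume "coded s t B k (int i) v"
    then obtain w where w: "length w = m" "w \<in> E" "g w = v"
      "\<forall>j<m. 1 + (int i + 1) * t dvd s ! j - w ! j \<and> - B \<le> w ! j \<and> w ! j \<le> B"
      unfolding coded_def by blast
    have "w = u i"
    proof (rule nth_equalityI)
      show "length w = length (u i)"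
        using w(1) len u(1) by simp
      show "w ! j = u i ! j" if "j < length w" for j
        using beta[OF i, of j "w ! j"] w that by (simp add: s_def)
    qed
    then show "v = [int i] \<cdot> a"
      using w(3) u(2) by simp
  next
    assume "v = [int i] \<cdot> a"
    moreover have "\<forall>j<m. 1 + (int i + 1) * t dvd s ! j - u i ! j \<and> - B \<le> u i ! j \<and> u i ! j \<le> B"
    proof (intro allI impI)
      fix j assume "j < m"
      then show "1 + (int i + 1) * t dvd s ! j - u i ! j \<and> - B \<le> u i ! j \<and> u i ! j \<le> B"
        using beta[OF i, of j "u i ! j"] by (simp add: s_def)
    qed
    ultimately show "coded s t B k (int i) v"
      unfolding coded_def using i k u[of i] len[of "u i"] by (intro conjI exI[of _ "u i"]) simp_all
  qed
  have "codes_multiples a s t B k"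
    unfolding codes_multiples_def
  proof (intro allI ballI impI)
    fix i v assume v: "v \<in> carrier R" "coded s t B k i v"
    then obtain n where n: "i = int n" "n \<le> nat k"
      unfolding coded_def by (metis nat_mono zero_le_imp_eq_int nat_int)
    then have v_eq: "v = [int n] \<cdot> a"
      using coded_iff v by simp
    show "i = 0 \<and> v = \<zero> \<or> (\<exists>w\<in>carrier R. v = w \<oplus> a \<and> coded s t B k (i - 1) w)"
    proof (cases n)
      case 0
      then show ?thesis using n v_eq a by simp
    next
      case (Suc n')
      then have "v = [int n'] \<cdot> a \<oplus> a" "coded s t B k (i - 1) ([int n'] \<cdot> a)"
        using n v_eq a coded_iff[of n'] by (simp_all add: add.int_pow_mult add.m_comm)
      then show ?thesis
        using a by (metis add.int_pow_closed)
    qed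
  qed
  moreover have "coded s t B k k ([k] \<cdot> a)"
    using coded_iff[of "nat k" "[k] \<cdot> a"] k by simp
  ultimately show ?thesis
    by (intro exI[of _ s] exI[of _ t] exI[of _ B]) (simp add: s_def)
qed

text \<open>Both the correctness of the code and the fact that it reaches k a at k transfer. Hence
  \<sigma>(k a) is coded at \<tau> k by a correct code, and must be \<tau> k times a.\<close>

lemma \<sigma>_multiple_nonneg:
  assumes a: "a \<in> carrier R" and k: "\<And>n. 0 \<le> k n"
  shows "almost_all (\<lambda>n. \<sigma> (\<lambda>n. [k n] \<cdot> a) n = [\<tau> k n] \<cdot> a)"
proof -
  have "\<forall>n. \<exists>s t B. length s = m \<and> codes_multiples a s t B (k n) \<and> coded s t B (k n) (k n) ([k n] \<cdot> a)"
    using codes_multiples_exist[OF a k] by blast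
  then obtain s' t B where s': "\<And>n. length (s' n) = m"
    and codes: "\<And>n. codes_multiples a (s' n) (t n) (B n) (k n)"
    and k_coded: "\<And>n. coded (s' n) (t n) (B n) (k n) (k n) ([k n] \<cdot> a)"
    by metis
  define s where "s = map (\<lambda>j n. s' n ! j) [0..<m]"
  have s: "length s = m" "\<And>n. at_index n s = s' n"
    using s' by (auto simp: s_def intro!: nth_equalityI)
  let ?x = "\<lambda>n. [k n] \<cdot> a"
  have x: "?x \<in> internal (carrier R)"
    using a by (intro internalI) simp
  have "almost_all (\<lambda>n. codes_multiples a (at_index n (map \<tau> s)) (\<tau> t n) (\<tau> B n) (\<tau> k n))"
    using same_truth_codes_multiples[OF s(1) a, of t B k] codes unfolding s(2) same_truth_def by simp
  moreover have "almost_all (\<lambda>n. coded (at_index n (map \<tau> s)) (\<tau> t n) (\<tau> B n) (\<tau> k n) (\<tau> k n) (\<sigma> ?x n))"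
    using same_truth_coded[OF transfers_to_\<tau> x s(1), of t B k k] k_coded unfolding s(2) same_truth_def by simp
  ultimately show ?thesis
  proof eventually_elim
    case (elim n)
    then have "0 \<le> \<tau> k n"
      by (simp add: coded_def)
    then obtain i where i: "\<tau> k n = int i"
      by (metis zero_le_imp_eq_int)
    show ?case
      using codes_multiples_sound[OF a elim(1), of "\<sigma> ?x n" i] elim(2) x \<sigma>_closed[of ?x]
      unfolding i by (simp add: internalD)
  qed
qed

text \<open>Writing x = g(u), compatibility gives \<sigma> x = g(\<tau> u) = g(u).\<close>

lemma \<sigma>_identity:
  assumes "\<And>k. almost_all (\<lambda>n. \<tau> k n = k n)" and x: "x \<in> internal (carrier R)"
  shows "almost_all (\<lambda>n. \<sigma> x n = x n)"
proof -
  have "\<forall>n. \<exists>u. u \<in> E \<and> g u = x n"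
    using g_onto internalD[OF x] by (metis imageE)
  then obtain u' where u': "\<And>n. u' n \<in> E" "\<And>n. g (u' n) = x n"
    by metis
  define u where "u = map (\<lambda>j n. u' n ! j) [0..<m]"
  have "length (u' n) = m" for n
    using E u'(1) by (auto simp: tuples_def)
  then have u: "length u = m" "\<And>n. at_index n u = u' n"
    by (auto simp: u_def intro!: nth_equalityI)
  have "almost_all (\<lambda>i. at_index i (map \<tau> u) \<in> E \<and> g (at_index i (map \<tau> u)) = \<sigma> x i)"
    using same_truth_graph[OF graph u(1), of x] x u' unfolding u(2) same_truth_def by simp
  moreover have "almost_all (\<lambda>n. map (\<lambda>k. \<tau> k n) u = map (\<lambda>k. k n) u)"
    using assms(1) by (intro almost_all_map_cong)
  ultimately show ?thesis
  proof eventually_elim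
    case (elim n)
    have "at_index n (map \<tau> u) = u' n"
      using elim(2) u(2)[of n] by (simp add: comp_def)
    then show ?case using elim(1) u'(2)[of n] by simp
  qed
qed

end

section \<open>Rings with infinite annihilator\<close>

text \<open>The sequence d^2 is not almost everywhere of the form \<alpha> + \<beta> d: a quadratic
  polynomial has finitely many roots, d is injective and U contains all cofinite sets. Null
  sequences lie in the subspace as well, so \<chi> depends only on classes.\<close>

lemma (in ultrafilter) quadratic_functional:
  fixes d :: "'i \<Rightarrow> int"
  assumes free: "\<And>S. finite S \<Longrightarrow> almost_all (\<lambda>i. i \<notin> S)" and d: "inj d"
  shows "\<exists>\<chi> :: ('i \<Rightarrow> rat) \<Rightarrow> rat. (\<forall>x y. \<chi> (\<lambda>i. x i + y i) = \<chi> x + \<chi> y) \<and>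
    (\<forall>r x. \<chi> (\<lambda>i. r * x i) = r * \<chi> x) \<and>
    (\<forall>x. (\<exists>\<alpha> \<beta>. almost_all (\<lambda>i. x i = \<alpha> + \<beta> * of_int (d i))) \<longrightarrow> \<chi> x = 0) \<and>
    \<chi> (\<lambda>i. of_int (d i * d i)) = 1"
proof -
  let ?V = "{x :: 'i \<Rightarrow> rat. \<exists>\<alpha> \<beta>. almost_all (\<lambda>i. x i = \<alpha> + \<beta> * of_int (d i))}"
  have zero: "(\<lambda>i. 0) \<in> ?V"
    by (intro CollectI exI[of _ 0]) simp
  have add: "(\<lambda>i. x i + y i) \<in> ?V" if "x \<in> ?V" "y \<in> ?V" for x y
  proof -
    obtain \<alpha> \<beta> \<alpha>' \<beta>' where "almost_all (\<lambda>i. x i = \<alpha> + \<beta> * of_int (d i))"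
      "almost_all (\<lambda>i. y i = \<alpha>' + \<beta>' * of_int (d i))"
      using \<open>x \<in> ?V\<close> \<open>y \<in> ?V\<close> by blast
    then have "almost_all (\<lambda>i. x i + y i = (\<alpha> + \<alpha>') + (\<beta> + \<beta>') * of_int (d i))"
      by eventually_elim (simp add: algebra_simps)
    then show ?thesis by blast
  qed
  have scale: "(\<lambda>i. r * x i) \<in> ?V" if "x \<in> ?V" for r x
  proof -
    obtain \<alpha> \<beta> where "almost_all (\<lambda>i. x i = \<alpha> + \<beta> * of_int (d i))"
      using \<open>x \<in> ?V\<close> by blast
    then have "almost_all (\<lambda>i. r * x i = r * \<alpha> + (r * \<beta>) * of_int (d i))"
      by eventually_elim (simp add: algebra_simps)
    then show ?thesis by blast
  qed
  have "(\<lambda>i. of_int (d i * d i)) \<notin> ?V"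
  proof
    assume "(\<lambda>i. of_int (d i * d i)) \<in> ?V"
    then obtain \<alpha> \<beta> :: rat where eq: "almost_all (\<lambda>i. of_int (d i * d i) = \<alpha> + \<beta> * of_int (d i))"
      by blast
    let ?S = "{i. of_int (d i * d i) = \<alpha> + \<beta> * of_int (d i)}"
    have "finite {x. poly [:- \<alpha>, - \<beta>, 1:] x = 0}"
      by (intro poly_roots_finite) simp
    moreover have "?S \<subseteq> (\<lambda>i. of_int (d i)) -` {x. poly [:- \<alpha>, - \<beta>, 1:] x = 0}"
      by (auto simp: algebra_simps)
    moreover have "inj (\<lambda>i. of_int (d i) :: rat)"
      using d by (auto simp: inj_def)
    ultimately have "finite ?S"
      using finite_subset finite_vimageI by blast
    from free[OF this] eq have "almost_all (\<lambda>i. False)"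
      by eventually_elim simp
    then show False by simp
  qed
  from rational_functional_separating[OF zero add scale this] show ?thesis
    by simp
qed

section \<open>The isolator of the square and functionals vanishing on it\<close>

context nonassoc_ring
begin

lemma ring_square_subgroup: "subgroup (ring_square R) (add_monoid R)"
  unfolding ring_square_def using m_closed
  by (intro group.generate_is_subgroup add.group_axioms) auto

lemma ring_square_mult: "x \<in> carrier R \<Longrightarrow> y \<in> carrier R \<Longrightarrow> x \<otimes> y \<in> ring_square R"
  unfolding ring_square_def by (intro generate.incl) blast

lemma ring_square_multiple: "x \<in> ring_square R \<Longrightarrow> [(n::nat)] \<cdot> x \<in> ring_square R"
  using add.subgroup_int_pow_closed[OF ring_square_subgroup, of x "int n"]
  by (simp add: add_pow_int_ge)

lemma ring_square_subset_Delta: "ring_square R \<subseteq> Delta R"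
proof
  fix x assume x: "x \<in> ring_square R"
  then have "x \<in> carrier R"
    using subgroup.subset[OF ring_square_subgroup] by auto
  then show "x \<in> Delta R"
    using x by (auto simp: Delta_def intro!: exI[of _ 1])
qed

lemma Delta_subgroup: "subgroup (Delta R) (add_monoid R)"
proof (rule subgroup.intro)
  interpret sq: subgroup "ring_square R" "add_monoid R"
    by (rule ring_square_subgroup)
  show "Delta R \<subseteq> carrier (add_monoid R)"
    by (auto simp: Delta_def)
  show "\<one>\<^bsub>add_monoid R\<^esub> \<in> Delta R"
    using ring_square_subset_Delta sq.one_closed by blast
  show "x \<otimes>\<^bsub>add_monoid R\<^esub> y \<in> Delta R" if D: "x \<in> Delta R" "y \<in> Delta R" for x y
  proof -
    obtain p q :: nat where p: "1 \<le> p" "[p] \<cdot> x \<in> ring_square R" and q: "1 \<le> q" "[q] \<cdot> y \<in> ring_square R"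
      using D unfolding Delta_def by blast
    have xy: "x \<in> carrier R" "y \<in> carrier R"
      using D by (auto simp: Delta_def)
    have "[(p * q)] \<cdot> (x \<oplus> y) = [q] \<cdot> ([p] \<cdot> x) \<oplus> [p] \<cdot> ([q] \<cdot> y)"
      using xy by (simp add: add.nat_pow_distrib add.nat_pow_pow mult.commute)
    also have "\<dots> \<in> ring_square R"
      using sq.m_closed[OF ring_square_multiple[OF p(2), of q] ring_square_multiple[OF q(2), of p]] by simp
    finally show ?thesis
      using xy p q unfolding Delta_def by (auto intro!: exI[of _ "p * q"])
  qed
  show "inv\<^bsub>add_monoid R\<^esub> x \<in> Delta R" if D: "x \<in> Delta R" for x
  proof -
    obtain p :: nat where p: "1 \<le> p" "[p] \<cdot> x \<in> ring_square R"
      using D unfolding Delta_def by blast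
    have x: "x \<in> carrier R"
      using D by (simp add: Delta_def)
    have "[p] \<cdot> (\<ominus> x) = \<ominus> ([p] \<cdot> x)"
      using x by (rule add.nat_pow_inv)
    also have "\<dots> \<in> ring_square R"
      using sq.m_inv_closed[OF p(2)] by (simp add: a_inv_def)
    finally show ?thesis
      using x p(1) unfolding Delta_def a_inv_def[symmetric] by (auto intro!: exI[of _ p])
  qed
qed

lemma Delta_pure:
  assumes "x \<in> carrier R" "0 < (n::nat)" "[n] \<cdot> x \<in> Delta R"
  shows "x \<in> Delta R"
proof -
  obtain p :: nat where "1 \<le> p" "[p] \<cdot> ([n] \<cdot> x) \<in> ring_square R"
    using assms(3) unfolding Delta_def by blast
  then show ?thesis
    using assms(1,2) unfolding Delta_def by (auto simp: add.nat_pow_pow intro!: exI[of _ "n * p"])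
qed

end

context FDZ_ring
begin

lemma infinite_Ann_element:
  assumes "infinite (Ann R)"
  shows "\<exists>a\<in>Ann R. \<forall>n::nat. 0 < n \<longrightarrow> [n] \<cdot> a \<noteq> \<zero>"
proof (rule ccontr)
  assume neg: "\<not> ?thesis"
  have tors: "\<exists>n::nat. 0 < n \<and> [n] \<cdot> a = \<zero>" if "a \<in> Ann R" for a
    using neg that by metis
  obtain S where S: "finite S" "S \<subseteq> carrier R" "generate (add_monoid R) S = carrier R"
    using additively_fin_gen by blast
  have "finite (Ann R)"
  proof (rule add.finite_torsion_subgroup[OF S(1,2) Ann_subgroup])
    show "Ann R \<subseteq> generate (add_monoid R) S"
      unfolding S(3) by (auto simp: Ann_def)
  qed (rule tors)
  then show False using assms by simp
qed

lemma functional_vanishing_on_Delta: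
  assumes "Delta R \<noteq> carrier R"
  shows "\<exists>(\<rho> :: 'a \<Rightarrow> int) b. (\<forall>x\<in>carrier R. \<forall>y\<in>carrier R. \<rho> (x \<oplus> y) = \<rho> x + \<rho> y) \<and>
    (\<forall>x\<in>Delta R. \<rho> x = 0) \<and> b \<in> carrier R \<and> \<rho> b \<noteq> 0"
proof -
  obtain S where S: "finite S" "S \<subseteq> carrier R" "generate (add_monoid R) S = carrier R"
    using additively_fin_gen by blast
  obtain b where b: "b \<in> carrier R" "b \<notin> Delta R"
    using assms by (auto simp: Delta_def)
  have "\<exists>\<rho> :: 'a \<Rightarrow> int. (\<forall>x\<in>carrier R. \<forall>y\<in>carrier R. \<rho> (x \<oplus> y) = \<rho> x + \<rho> y) \<and>
      (\<forall>x\<in>Delta R. \<rho> x = 0) \<and> \<rho> b \<noteq> 0"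
    by (rule add.integer_hom_separating[OF S Delta_subgroup _ b]) (rule Delta_pure)
  then obtain \<rho> :: "'a \<Rightarrow> int" where "\<forall>x\<in>carrier R. \<forall>y\<in>carrier R. \<rho> (x \<oplus> y) = \<rho> x + \<rho> y"
    "\<forall>x\<in>Delta R. \<rho> x = 0" "\<rho> b \<noteq> 0"
    by (elim exE conjE)
  then show ?thesis
    using b(1) by (intro exI[of _ \<rho>] exI[of _ b] conjI)
qed

end

theorem mainTheorem2:
  fixes A :: "('a, 'm) ring_scheme"
  assumes "FDZ_ring A"
    and "infinite (Ann A)"
    and "Delta A \<noteq> carrier A"
  shows "\<not> bi_interpretable (ring_structure A) (ring_structure \<Z>)"
proof
  assume "bi_interpretable (ring_structure A) (ring_structure \<Z>)"
  then obtain dim D f m E g where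
    f: "interpretation_in (ring_structure \<Z>) (ring_structure A) dim D f" and
    g: "interpretation_in (ring_structure A) (ring_structure \<Z>) m E g" and
    graph: "definable (ring_structure A) (1 + m * dim) (composite_graph m D f E g)"
    unfolding bi_interpretable_def by blast
  interpret FDZ_ring A by fact
  obtain a where a: "a \<in> Ann A" "\<And>n::nat. 0 < n \<Longrightarrow> [n] \<cdot>\<^bsub>A\<^esub> a \<noteq> \<zero>\<^bsub>A\<^esub>"
    using infinite_Ann_element[OF assms(2)] by blast
  obtain \<rho> :: "'a \<Rightarrow> int" and b where
    \<rho>: "\<And>x y. x \<in> carrier A \<Longrightarrow> y \<in> carrier A \<Longrightarrow> \<rho> (x \<oplus>\<^bsub>A\<^esub> y) = \<rho> x + \<rho> y"
      "\<And>x. x \<in> Delta A \<Longrightarrow> \<rho> x = 0" and b: "b \<in> carrier A" "\<rho> b \<noteq> 0"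
    using functional_vanishing_on_Delta[OF assms(3)] by blast

  obtain U :: "nat filter" where U: "U \<le> sequentially" "U \<noteq> bot"
    "\<And>P. eventually P U \<or> eventually (\<lambda>i. \<not> P i) U"
    using ultrafilter_extension[of sequentially] by auto
  interpret ultrafilter U
    using U by unfold_locales auto
  have free: "almost_all (\<lambda>i. i \<notin> S)" if "finite S" for S
    using U(1) that by (auto simp: filter_leD cofinite_eq_sequentially[symmetric] eventually_cofinite)
  \<comment> \<open>The successor keeps d injective, as 0! = 1!.\<close>
  define d :: "nat \<Rightarrow> int" where "d i = fact (Suc i)" for i
  have d_pos: "0 < d i" for i
    by (simp add: d_def)
  have "inj d"
    by (rule linorder_injI) (simp add: d_def fact_less_mono less_imp_neq del: fact_Suc)
  from quadratic_functional[OF free this] obtain \<chi> :: "(nat \<Rightarrow> rat) \<Rightarrow> rat" where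
    \<chi>_add: "\<And>x y. \<chi> (\<lambda>i. x i + y i) = \<chi> x + \<chi> y" and
    \<chi>_scale: "\<And>r x. \<chi> (\<lambda>i. r * x i) = r * \<chi> x" and
    \<chi>_linear: "\<And>x \<alpha> \<beta>. almost_all (\<lambda>i. x i = \<alpha> + \<beta> * of_int (d i)) \<Longrightarrow> \<chi> x = 0" and
    \<chi>_square: "\<chi> (\<lambda>i. of_int (d i * d i)) = 1"
    by blast
  have \<chi>_diff: "\<chi> (\<lambda>i. x i - y i) = \<chi> x - \<chi> y" for x y
    using \<chi>_add[of x "\<lambda>i. (-1) * y i"] \<chi>_scale[of "-1" y] by simp
  define \<phi> :: "(nat \<Rightarrow> int) \<Rightarrow> rat" where "\<phi> k = \<chi> (\<lambda>i. of_int (k i))" for k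
  define \<theta> :: "(nat \<Rightarrow> int) \<Rightarrow> nat \<Rightarrow> int" where "\<theta> k i = \<lfloor>\<phi> k * of_int (d i)\<rfloor>" for k i
  have \<phi>_add: "\<phi> (\<lambda>i. k i + l i) = \<phi> k + \<phi> l" for k l
    by (simp add: \<phi>_def \<chi>_add)
  have \<phi>_scale: "\<phi> (\<lambda>i. c * k i) = of_int c * \<phi> k" for c k
    by (simp add: \<phi>_def \<chi>_scale)
  have \<phi>_cong: "\<phi> k = \<phi> l" if "almost_all (\<lambda>i. k i = l i)" for k l
  proof -
    have "almost_all (\<lambda>i. rat_of_int (k i) - of_int (l i) = 0 + 0 * of_int (d i))"
      using that by eventually_elim simp
    from \<chi>_linear[OF this] show ?thesis
      by (simp add: \<chi>_diff \<phi>_def)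
  qed
  \<comment> \<open>With \<phi> k = p / q, the denominator q divides (i + 1)! for all i \<ge> q, so
    the floor in \<theta> changes something at finitely many indices at most.\<close>
  have \<theta>: "almost_all (\<lambda>i. of_int (\<theta> k i) = \<phi> k * of_int (d i))" for k
  proof -
    obtain p q where "quotient_of (\<phi> k) = (p, q)"
      by (cases "quotient_of (\<phi> k)")
    then have r: "\<phi> k = of_int p / of_int q" and q: "0 < q"
      using quotient_of_div quotient_of_denom_pos by blast+
    have "almost_all (\<lambda>i. i \<notin> {..<nat q})"
      by (rule free) simp
    then show ?thesis
    proof eventually_elim
      case (elim i)
      then have "nat q dvd fact (Suc i)"
        using q by (intro dvd_fact) auto
      then have "int (nat q) dvd int (fact (Suc i))"
        by (simp only: int_dvd_int_iff)
      then obtain c where "d i = q * c"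
        using q by (auto simp: d_def simp del: fact_Suc)
      then have "\<phi> k * of_int (d i) = of_int (p * c)"
        using q by (simp add: r)
      then show ?case
        by (simp add: \<theta>_def del: of_int_mult)
    qed
  qed
  have \<theta>_0: "almost_all (\<lambda>i. \<theta> k i = 0)" if "\<phi> k = 0" for k
    by (simp add: \<theta>_def that)

  interpret shear A U \<rho> a \<theta>
  proof unfold_locales
    show "\<rho> (x \<otimes>\<^bsub>A\<^esub> y) = 0" if "x \<in> carrier A" "y \<in> carrier A" for x y
      using ring_square_mult[OF that] ring_square_subset_Delta by (intro \<rho>(2)) blast
    show "almost_all (\<lambda>i. \<theta> k i = \<theta> l i)" if "almost_all (\<lambda>i. k i = l i)" for k l
      using \<phi>_cong[OF that] by (simp add: \<theta>_def)
    show "almost_all (\<lambda>i. \<theta> (\<lambda>i. k i + l i) i = \<theta> k i + \<theta> l i)" for k l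
      using \<theta>[of "\<lambda>i. k i + l i"] \<theta>[of k] \<theta>[of l]
    proof eventually_elim
      case (elim i)
      then have "rat_of_int (\<theta> (\<lambda>i. k i + l i) i) = of_int (\<theta> k i + \<theta> l i)"
        by (simp add: \<phi>_add distrib_right)
      then show ?case by (simp only: of_int_eq_iff)
    qed
    show "almost_all (\<lambda>i. \<theta> (\<lambda>_. c) i = 0)" for c
      by (rule \<theta>_0) (simp add: \<phi>_def \<chi>_linear[of _ "of_int c" 0])
    show "almost_all (\<lambda>i. \<theta> (\<lambda>i. \<theta> k i * c) i = 0)" for k c
    proof (rule \<theta>_0)
      \<comment> \<open>Multiples of values of \<theta> are rational multiples of d almost
        everywhere, and \<chi> kills these.\<close>
      have "almost_all (\<lambda>i. rat_of_int (\<theta> k i * c) = 0 + (\<phi> k * of_int c) * of_int (d i))"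
        using \<theta>[of k] by eventually_elim simp
      then show "\<phi> (\<lambda>i. \<theta> k i * c) = 0"
        unfolding \<phi>_def by (rule \<chi>_linear)
    qed
  qed (use \<rho> a in auto)

  interpret ultrapower_automorphism U "ring_structure A" \<sigma>
    by (rule ultrapower_automorphism)
  have "E \<subseteq> tuples UNIV m" "g ` E = carrier A"
    using g unfolding interpretation_in_def definable_def ring_structure_def tuples_def by auto
  with f graph interpret ring_with_integers A U \<sigma> dim D f m E g
    by unfold_locales

  have \<tau>_nonneg: "almost_all (\<lambda>n. rat_of_int (\<tau> k n) = of_int (k n) + of_int (\<rho> a) * \<phi> k * of_int (d n))"
    if k: "\<And>n. 0 \<le> k n" for k
  proof -
    have \<rho>_k: "(\<lambda>n. \<rho> ([k n] \<cdot>\<^bsub>A\<^esub> a)) = (\<lambda>n. \<rho> a * k n)"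
      by (simp add: \<rho>_multiple mult.commute)
    show ?thesis
      using \<sigma>_multiple_nonneg[of a k, OF a_closed k] \<theta>[of "\<lambda>n. \<rho> a * k n"]
    proof eventually_elim
      case (elim n)
      have "[\<tau> k n] \<cdot>\<^bsub>A\<^esub> a = [(k n + \<theta> (\<lambda>n. \<rho> a * k n) n)] \<cdot>\<^bsub>A\<^esub> a"
        using elim(1) unfolding \<sigma>_def \<rho>_k by (simp add: add.int_pow_mult)
      then have "\<tau> k n = k n + \<theta> (\<lambda>n. \<rho> a * k n) n"
        using multiple_eq_iff[OF a_closed a(2)] by simp
      then show ?case
        using elim(2) by (simp add: \<phi>_scale)
    qed
  qed

  show False
  proof (cases "\<rho> a = 0")
    case True
    have "almost_all (\<lambda>n. \<tau> k n = k n)" for k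
    proof -
      \<comment> \<open>The formula for \<tau> is known for nonnegative sequences only; additivity
        extends it through positive and negative parts.\<close>
      let ?p = "\<lambda>n. max (k n) 0" and ?q = "\<lambda>n. max (- k n) 0"
      have "almost_all (\<lambda>n. rat_of_int (\<tau> ?p n) = of_int (?p n))"
        "almost_all (\<lambda>n. rat_of_int (\<tau> ?q n) = of_int (?q n))"
        using \<tau>_nonneg[of ?p] \<tau>_nonneg[of ?q] True by simp_all
      moreover have "(\<lambda>n. k n + ?q n) = ?p"
        by auto
      then have "almost_all (\<lambda>n. \<tau> ?p n = \<tau> k n + \<tau> ?q n)"
        using \<tau>_add[of k ?q] by (simp only:)
      ultimately show ?thesis
      proof eventually_elim
        case (elim n)
        then have "?p n = \<tau> k n + ?q n"
          by (simp only: of_int_eq_iff)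
        then show ?case by linarith
      qed
    qed
    note \<sigma>_id = \<sigma>_identity[OF this]
    \<comment> \<open>An element moved by \<sigma>: its \<rho>-value is \<rho>(b) d^2, so the shear
      adds \<rho>(b) d times a, which is nonzero as a has infinite order.\<close>
    let ?x = "\<lambda>n. [(d n * d n)] \<cdot>\<^bsub>A\<^esub> b"
    have x: "?x \<in> internal (carrier A)"
      using b(1) by (intro internalI) simp
    have \<rho>_x: "(\<lambda>n. \<rho> (?x n)) = (\<lambda>n. \<rho> b * (d n * d n))"
      using b(1) by (simp add: \<rho>_multiple mult.commute)
    have "\<phi> (\<lambda>n. \<rho> b * (d n * d n)) = of_int (\<rho> b)"
      unfolding \<phi>_scale using \<chi>_square by (simp add: \<phi>_def)
    with \<theta>[of "\<lambda>n. \<rho> b * (d n * d n)"]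
    have "almost_all (\<lambda>n. rat_of_int (\<theta> (\<lambda>n. \<rho> b * (d n * d n)) n) = of_int (\<rho> b * d n))"
      by simp
    with \<sigma>_id[OF x] have "almost_all (\<lambda>n. False)"
    proof eventually_elim
      case (elim n)
      have "?x n \<oplus>\<^bsub>A\<^esub> [(\<rho> b * d n)] \<cdot>\<^bsub>A\<^esub> a = ?x n"
        using elim unfolding \<sigma>_def \<rho>_x of_int_eq_iff by simp
      then have "[(\<rho> b * d n)] \<cdot>\<^bsub>A\<^esub> a = [(0::int)] \<cdot>\<^bsub>A\<^esub> a"
        using b(1) by simp
      then have "\<rho> b * d n = 0"
        using multiple_eq_iff[OF a_closed a(2)] by blast
      then show ?case using b(2) d_pos[of n] by simp
    qed
    then show False by simp
  next
    case False
    let ?k = "\<lambda>n. d n * d n" and ?c = "rat_of_int (\<rho> a)"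
    \<comment> \<open>The value of \<phi> at d^4 was never prescribed; it matters only that it is a
      standard rational.\<close>
    let ?\<gamma> = "\<phi> (\<lambda>n. ?k n * ?k n)"
    have k1: "\<phi> ?k = 1"
      using \<chi>_square by (simp add: \<phi>_def)
    have "almost_all (\<lambda>n. rat_of_int (\<tau> ?k n) = of_int (?k n) + ?c * \<phi> ?k * of_int (d n))"
      "almost_all (\<lambda>n. rat_of_int (\<tau> (\<lambda>n. ?k n * ?k n) n) = of_int (?k n * ?k n) + ?c * ?\<gamma> * of_int (d n))"
      by (rule \<tau>_nonneg, simp)+
    then have "almost_all (\<lambda>n. 2 * rat_of_int (?k n) = ?\<gamma> + (- ?c) * of_int (d n))"
      using \<tau>_mult[of ?k ?k]
    proof eventually_elim
      case (elim n)
      \<comment> \<open>With c = \<rho>(a), this is d^4 + c \<gamma> d = (d^2 + c d)^2. Cancelling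
        d^4 and dividing by c d leaves \<gamma> = 2 d^2 + c d.\<close>
      have "of_int (?k n * ?k n) + ?c * ?\<gamma> * of_int (d n) = (of_int (?k n) + ?c * of_int (d n))\<^sup>2"
        using elim by (simp add: k1 power2_eq_square)
      then have "(?c * of_int (d n)) * ?\<gamma> = (?c * of_int (d n)) * (2 * of_int (?k n) + ?c * of_int (d n))"
        by (simp add: power2_eq_square algebra_simps)
      moreover have "?c * of_int (d n) \<noteq> 0"
        using False d_pos[of n] by simp
      ultimately show ?case by simp
    qed
    then have "\<chi> (\<lambda>n. 2 * rat_of_int (?k n)) = 0"
      by (rule \<chi>_linear)
    then show False
      unfolding \<chi>_scale using \<chi>_square by simp
  qed
qed


end
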